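(* Let $\eta_0>0$, $\xi>0$ and $\eta_1>-2$, let $\mathbf{r}\in\mathbb{R}^2$ with Euclidean norm $r=\|\mathbf{r}\|$, and let $h=r/\xi$. Let the Spartan (SSRF) covariance function in $\mathbb{R}^2$ be defined by $$C_{xx}(\mathbf{r};\boldsymbol\theta)=\frac{\eta_0\,\xi^2}{2\pi}\int_0^\infty \frac{k\,J_0(kr)}{1+\eta_1(k\xi)^2+(k\xi)^4}\,dk .$$ Then, as a function of $h>0$ (the value at $h=0$ being given by the integral, equivalently by the limit $h\to0^+$), $C_{xx}$ is given by $$C_{xx}(h;\boldsymbol\theta)=\frac{\eta_0\left[K_0(hz_+)-K_0(hz_-)\right]}{2\pi\sqrt{\eta_1^2-4}}\quad\text{if }\eta_1>2,$$ $$C_{xx}(h;\boldsymbol\theta)=\frac{\eta_0\,h}{4\pi}\,K_{-1}(h)\quad\text{if }\eta_1=2,$$ $$C_{xx}(h;\boldsymbol\theta)=\frac{\eta_0\,\Im\left[K_0(hz_+)\right]}{\pi\sqrt{4-\eta_1^2}}\quad\text{if }|\eta_1|<2,$$ where $z_\pm$ are the square roots with positive real part of $$z_\pm^2=\frac{\eta_1\mp\Delta}{2},\qquad \Delta=\sqrt{\eta_1^2-4}.$$ Moreover, every second-order stationary random field on $\mathbb{R}^2$ with covariance function $C_{xx}$ is continuous but not differentiable in the mean square sense.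
   Context: $J_0$ is the Bessel function of the first kind of order $0$; $K_\nu$ is the modified Bessel function of the second kind of order $\nu$; $\Im$ denotes the imaginary part. For $|\eta_1|<2$ the discriminant is $\Delta=i\sqrt{4-\eta_1^2}$. The parameters are $\eta_0$ (amplitude), $\xi$ (characteristic length) and $\eta_1$ (rigidity coefficient); $\boldsymbol\theta$ denotes the parameter vector. A second-order stationary random field $X$ on $\mathbb{R}^2$ is a real-valued field with constant mean and covariance $\mathrm{Cov}(X(\mathbf{s}),X(\mathbf{s}+\mathbf{r}))=C_{xx}(\mathbf{r})$ depending only on the lag $\mathbf{r}$. It is mean-square continuous if $\mathbb{E}|X(\mathbf{s}+\mathbf{r})-X(\mathbf{s})|^2\to0$ as $\mathbf{r}\to0$ for every $\mathbf{s}$, and mean-square differentiable if its first-order partial derivatives exist as mean-square limits of difference quotients at every $\mathbf{s}$. *)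

theory Defs
  imports "HOL-Probability.Probability"
begin

section \<open>Bessel functions\<close>

definition Bessel_J :: "nat \<Rightarrow> real \<Rightarrow> real" where
  "Bessel_J n x = (\<Sum>m. (-1) ^ m / (fact m * fact (m + n)) * (x / 2) ^ (2 * m + n))"

text \<open>
  The factor \<open>(z / 2) powr \<nu>\<close> is the principal branch.  At \<open>z = 0\<close> it is \<open>0\<close> by convention,
  so the modified functions below are only meaningful for \<open>z \<noteq> 0\<close>.
\<close>

definition Bessel_I :: "complex \<Rightarrow> complex \<Rightarrow> complex" where
  "Bessel_I \<nu> z =
     (z / 2) powr \<nu> * (\<Sum>m. rGamma (\<nu> + of_nat m + 1) / fact m * (z\<^sup>2 / 4) ^ m)"

definition Bessel_K_quotient :: "complex \<Rightarrow> complex \<Rightarrow> complex" where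
  "Bessel_K_quotient \<nu> z =
     of_real pi / 2 * (Bessel_I (- \<nu>) z - Bessel_I \<nu> z) / sin (\<nu> * of_real pi)"

text \<open>
  At integer order the defining quotient is \<open>0 / 0\<close>, and the function is its limit in the order.
\<close>

definition Bessel_K :: "complex \<Rightarrow> complex \<Rightarrow> complex" where
  "Bessel_K \<nu> z =
     (if \<nu> \<in> \<int> then Lim (at \<nu>) (\<lambda>\<mu>. Bessel_K_quotient \<mu> z) else Bessel_K_quotient \<nu> z)"


section \<open>The Spartan covariance function\<close>

definition ssrf_integrand :: "real \<Rightarrow> real \<Rightarrow> real \<Rightarrow> real \<Rightarrow> real" where
  "ssrf_integrand \<xi> \<eta>1 r k =
     k * Bessel_J 0 (k * r) / (1 + \<eta>1 * (k * \<xi>)\<^sup>2 + (k * \<xi>) ^ 4)"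

definition ssrf_cov :: "real \<Rightarrow> real \<Rightarrow> real \<Rightarrow> real ^ 2 \<Rightarrow> real" where
  "ssrf_cov \<eta>0 \<xi> \<eta>1 r =
     \<eta>0 * \<xi>\<^sup>2 / (2 * pi) * (LBINT k:{0..}. ssrf_integrand \<xi> \<eta>1 (norm r) k)"

definition ssrf_disc :: "real \<Rightarrow> complex" where
  "ssrf_disc \<eta>1 = csqrt (of_real (\<eta>1\<^sup>2 - 4))"

definition ssrf_z_plus :: "real \<Rightarrow> complex" where
  "ssrf_z_plus \<eta>1 = csqrt ((of_real \<eta>1 - ssrf_disc \<eta>1) / 2)"

definition ssrf_z_minus :: "real \<Rightarrow> complex" where
  "ssrf_z_minus \<eta>1 = csqrt ((of_real \<eta>1 + ssrf_disc \<eta>1) / 2)"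

lemma ssrf_disc_real: "2 \<le> \<eta>1 \<Longrightarrow> ssrf_disc \<eta>1 = of_real (sqrt (\<eta>1\<^sup>2 - 4))"
proof -
  assume "2 \<le> \<eta>1"
  then have "2\<^sup>2 \<le> \<eta>1\<^sup>2" by (intro power_mono) auto
  then show ?thesis unfolding ssrf_disc_def by (subst csqrt_of_real_nonneg) auto
qed

lemma ssrf_disc_imaginary:
  assumes "\<bar>\<eta>1\<bar> < 2"
  shows "ssrf_disc \<eta>1 = \<i> * of_real (sqrt (4 - \<eta>1\<^sup>2))"
proof -
  have "\<eta>1\<^sup>2 < 4" using assms power2_strict_mono[of \<eta>1 2] by simp
  then show ?thesis unfolding ssrf_disc_def by (subst csqrt_of_real_nonpos) auto
qed

lemma Re_csqrt_pos:
  assumes "z \<notin> \<real>\<^sub>\<le>\<^sub>0"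
  shows "0 < Re (csqrt z)"
proof (rule ccontr)
  assume "\<not> 0 < Re (csqrt z)"
  moreover have "0 \<le> Re (csqrt z)" using csqrt_principal[of z] by auto
  ultimately have "Re (csqrt z) = 0" by simp
  then have "Re ((csqrt z)\<^sup>2) \<le> 0" "Im ((csqrt z)\<^sup>2) = 0"
    unfolding Re_power2 Im_power2 by simp_all
  with assms show False by (simp add: complex_nonpos_Reals_iff)
qed

lemma ssrf_z_square:
  "(ssrf_z_plus \<eta>1)\<^sup>2 = (of_real \<eta>1 - ssrf_disc \<eta>1) / 2"
  "(ssrf_z_minus \<eta>1)\<^sup>2 = (of_real \<eta>1 + ssrf_disc \<eta>1) / 2"
  by (simp_all add: ssrf_z_plus_def ssrf_z_minus_def)

lemma ssrf_z_Re_pos: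
  assumes "-2 < \<eta>1"
  shows "0 < Re (ssrf_z_plus \<eta>1)" "0 < Re (ssrf_z_minus \<eta>1)"
proof -
  have "(of_real \<eta>1 - ssrf_disc \<eta>1) / 2 \<notin> \<real>\<^sub>\<le>\<^sub>0 \<and> (of_real \<eta>1 + ssrf_disc \<eta>1) / 2 \<notin> \<real>\<^sub>\<le>\<^sub>0"
  proof (cases "2 \<le> \<eta>1")
    case True
    have "sqrt (\<eta>1\<^sup>2 - 4) < sqrt (\<eta>1\<^sup>2)" by (intro real_sqrt_less_mono) simp
    with True have "sqrt (\<eta>1\<^sup>2 - 4) < \<eta>1" by simp
    moreover have "0 \<le> sqrt (\<eta>1\<^sup>2 - 4)" using True power_mono[of 2 \<eta>1 2] by simp
    ultimately have "0 < \<eta>1 - sqrt (\<eta>1\<^sup>2 - 4)" "0 < \<eta>1 + sqrt (\<eta>1\<^sup>2 - 4)"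
      using True by linarith+
    then show ?thesis
      using True by (auto simp: ssrf_disc_real complex_nonpos_Reals_iff)
  next
    case False
    then have a: "\<bar>\<eta>1\<bar> < 2" using assms by auto
    then have "\<eta>1\<^sup>2 < 4" using power2_strict_mono[of \<eta>1 2] by simp
    then show ?thesis
      using a by (auto simp: ssrf_disc_imaginary complex_nonpos_Reals_iff)
  qed
  then show "0 < Re (ssrf_z_plus \<eta>1)" "0 < Re (ssrf_z_minus \<eta>1)"
    unfolding ssrf_z_plus_def ssrf_z_minus_def using Re_csqrt_pos by blast+
qed


section \<open>Second-order random fields\<close>

definition finite_second_moment :: "'w measure \<Rightarrow> ('w \<Rightarrow> real) \<Rightarrow> bool" where
  "finite_second_moment M Y \<longleftrightarrow> Y \<in> borel_measurable M \<and> integrable M (\<lambda>\<omega>. (Y \<omega>)\<^sup>2)"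

definition covariance :: "'w measure \<Rightarrow> ('w \<Rightarrow> real) \<Rightarrow> ('w \<Rightarrow> real) \<Rightarrow> real" where
  "covariance M Y Z =
     (\<integral>\<omega>. (Y \<omega> - integral\<^sup>L M Y) * (Z \<omega> - integral\<^sup>L M Z) \<partial>M)"

definition second_order_stationary ::
    "'w measure \<Rightarrow> (real ^ 2 \<Rightarrow> 'w \<Rightarrow> real) \<Rightarrow> (real ^ 2 \<Rightarrow> real) \<Rightarrow> bool" where
  "second_order_stationary M X C \<longleftrightarrow>
     prob_space M \<and>
     (\<forall>s. finite_second_moment M (X s)) \<and>
     (\<exists>m. \<forall>s. integral\<^sup>L M (X s) = m) \<and>
     (\<forall>s r. covariance M (X s) (X (s + r)) = C r)"

text \<open>
  Membership in \<open>L\<^sup>2\<close> is required explicitly, since the Bochner integral of a non-integrable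
  function is \<open>0\<close>.
\<close>

definition ms_tendsto ::
    "'w measure \<Rightarrow> ('a \<Rightarrow> 'w \<Rightarrow> real) \<Rightarrow> ('w \<Rightarrow> real) \<Rightarrow> 'a filter \<Rightarrow> bool" where
  "ms_tendsto M Y Z F \<longleftrightarrow>
     (\<forall>\<^sub>F t in F. finite_second_moment M (Y t)) \<and> finite_second_moment M Z \<and>
     ((\<lambda>t. \<integral>\<omega>. (Y t \<omega> - Z \<omega>)\<^sup>2 \<partial>M) \<longlongrightarrow> 0) F"

definition ms_continuous :: "'w measure \<Rightarrow> (real ^ 2 \<Rightarrow> 'w \<Rightarrow> real) \<Rightarrow> bool" where
  "ms_continuous M X \<longleftrightarrow> (\<forall>s. ms_tendsto M (\<lambda>r. X (s + r)) (X s) (at 0))"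

definition ms_differentiable :: "'w measure \<Rightarrow> (real ^ 2 \<Rightarrow> 'w \<Rightarrow> real) \<Rightarrow> bool" where
  "ms_differentiable M X \<longleftrightarrow>
     (\<forall>s i. \<exists>D. ms_tendsto M (\<lambda>t \<omega>. (X (s + t *\<^sub>R axis i 1) \<omega> - X s \<omega>) / t) D (at 0))"

end

theory Submission
  imports Defs "HOL-Complex_Analysis.Complex_Analysis"
begin

text \<open>
  After the substitution \<open>k \<mapsto> k / \<xi>\<close> the covariance at lag \<open>r\<close> is \<open>\<eta>0 / (2 * pi)\<close> times the integral of
  \<open>k * J\<^sub>0(k * h) / (1 + \<eta> * k\<^sup>2 + k ^ 4)\<close> over the positive half-line, where \<open>h = norm r / \<xi>\<close>.  The
  denominator factors as \<open>(k\<^sup>2 + a) * (k\<^sup>2 + b)\<close> with \<open>a\<close> and \<open>b\<close> the squares of \<open>z\<^sub>+\<close> and \<open>z\<^sub>-\<close>, and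
  partial fractions would reduce everything to the classical formula
  \<open>\<integral> k * J\<^sub>0(k * h) / (k\<^sup>2 + z\<^sup>2) dk = K\<^sub>0(h * z)\<close>.  That integral does not converge absolutely, so
  only its differences for two values of \<open>z\<close> are used (\<open>Bessel_K_0_diff\<close>).

  For real \<open>z\<close> the factor \<open>1 / (k\<^sup>2 + z\<^sup>2)\<close> is a mixture of Gaussians in \<open>k\<close>, and the Hankel transform
  of a Gaussian is a Gaussian (\<open>hankel_transform_gaussian\<close>).  Fubini's theorem turns the integral into
  one of the form \<open>\<integral> t powr (\<nu> - 1) * exp (- t - x / t) dt\<close> with \<open>x = (h * z)\<^sup>2 / 4\<close>, called
  \<open>heat_integral \<nu> x\<close> below.  The identification of this integral with \<open>K\<close> is the core of the proof.
  For orders \<open>0 < \<mu> < 1\<close> the pair of orders \<open>\<mu>\<close> and \<open>1 - \<mu>\<close> solves a first-order linear system in \<open>x\<close>,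
  which the power series defining \<open>K\<close> also solve, with the same values at \<open>0\<close> by the reflection formula
  of the Gamma function; a Wronskian argument shows that the two solutions agree
  (\<open>heat_integral_eq_bessel_series\<close>).  The integer orders \<open>0\<close> and \<open>-1\<close> follow by letting \<open>\<mu>\<close> tend to
  \<open>0\<close> and to \<open>1\<close>, since \<open>K\<close> is even in its order.  The existence of the limit in the order, over the
  complex numbers, holds because the power series is holomorphic in the order.

  Complex \<open>z\<close> are reached by analytic continuation in \<open>a = z\<^sup>2\<close> (\<open>Bessel_K_0_slit_plane\<close>): both sides are
  holomorphic in the plane without the nonpositive real axis, and they agree on the positive axis.
  In the critical case \<open>\<eta> = 2\<close> both poles coincide, and the mixture with weight \<open>t * exp (- t)\<close> leads
  directly to order \<open>1\<close>.

  The mean square properties depend on the covariance \<open>C\<close> only through the variogram: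
  \<open>E (X(s + r) - X(s))\<^sup>2 = 2 * (C(0) - C(r))\<close>.  Continuity of \<open>C\<close> at \<open>0\<close> is dominated convergence.  A mean
  square derivative would force \<open>C(0) - C(r)\<close> to be \<open>O(r\<^sup>2)\<close>, but \<open>1 - J\<^sub>0(x)\<close> is of order \<open>x\<^sup>2\<close> for small \<open>x\<close>
  and the integral of \<open>k ^ 3 / (1 + \<eta> * k\<^sup>2 + k ^ 4)\<close> diverges logarithmically, so the difference is at
  least a multiple of \<open>r\<^sup>2 * ln (1 / r)\<close> (\<open>spartan_integral_variogram\<close>).
\<close>

section \<open>Integrals depending on a parameter\<close>

text \<open>
  Limits at a point of a first-countable space are determined by sequences, so dominated convergence
  along sequences gives dominated convergence for continuous parameters.
\<close>

lemma tendsto_integral_dominated: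
  fixes f :: "'b::first_countable_topology \<Rightarrow> 'a \<Rightarrow> 'c::{banach,second_countable_topology}"
  assumes [measurable]: "\<And>y. f y \<in> borel_measurable M" "g \<in> borel_measurable M"
    and w: "integrable M w"
    and bound: "\<forall>\<^sub>F y in at a within S. \<forall>x\<in>space M. norm (f y x) \<le> w x"
    and lim: "\<And>x. x \<in> space M \<Longrightarrow> ((\<lambda>y. f y x) \<longlongrightarrow> g x) (at a within S)"
  shows "((\<lambda>y. integral\<^sup>L M (f y)) \<longlongrightarrow> integral\<^sup>L M g) (at a within S)"
  unfolding tendsto_at_iff_sequentially comp_def
proof (intro allI impI)
  fix X assume X: "\<forall>i. X i \<in> S - {a}" "X \<longlonglongrightarrow> a"
  then have XF: "filterlim X (at a within S) sequentially"
    by (auto simp: filterlim_at)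
  from eventually_compose_filterlim[OF bound XF]
  obtain N where N: "\<And>n. n \<ge> N \<Longrightarrow> \<forall>x\<in>space M. norm (f (X n) x) \<le> w x"
    by (auto simp: eventually_sequentially)
  show "(\<lambda>n. integral\<^sup>L M (f (X n))) \<longlonglongrightarrow> integral\<^sup>L M g"
  proof (rule LIMSEQ_offset[where k = N], rule integral_dominated_convergence[OF _ _ w])
    show "AE x in M. (\<lambda>n. f (X (n + N)) x) \<longlonglongrightarrow> g x"
      using lim XF by (intro AE_I2 LIMSEQ_ignore_initial_segment filterlim_compose[OF lim XF]) auto
    show "AE x in M. norm (f (X (n + N)) x) \<le> w x" for n
      using N[of "n + N"] by (intro AE_I2) auto
  qed auto
qed

text \<open>
  Differentiation under the integral sign: the mean value inequality bounds the difference quotients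
  by the majorant of the derivative, and dominated convergence applies.  The scalar field may be the
  real or the complex numbers; the real case serves the differential system for the heat integrals,
  the complex one the analytic continuation.
\<close>

lemma has_field_derivative_integral:
  fixes f :: "'b \<Rightarrow> 'a \<Rightarrow> 'b::{real_normed_field,banach,second_countable_topology}"
  assumes "\<delta> > 0"
    and meas [measurable]: "\<And>y. f y \<in> borel_measurable M" "f' a \<in> borel_measurable M"
    and int: "\<And>y. y \<in> ball a \<delta> \<Longrightarrow> integrable M (f y)"
    and deriv: "\<And>x y. x \<in> space M \<Longrightarrow> y \<in> ball a \<delta> \<Longrightarrow> ((\<lambda>y. f y x) has_field_derivative f' y x) (at y)"
    and bound: "\<And>x y. x \<in> space M \<Longrightarrow> y \<in> ball a \<delta> \<Longrightarrow> norm (f' y x) \<le> w x"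
    and w: "integrable M w"
  shows "((\<lambda>y. integral\<^sup>L M (f y)) has_field_derivative integral\<^sup>L M (f' a)) (at a)"
  unfolding has_field_derivative_iff
proof -
  have near: "\<forall>\<^sub>F y in at a. y \<in> ball a \<delta> \<and> y \<noteq> a"
    using \<open>\<delta> > 0\<close> by (auto simp: eventually_at dist_commute intro!: exI[of _ \<delta>])
  have "((\<lambda>y. \<integral>x. (f y x - f a x) / (y - a) \<partial>M) \<longlongrightarrow> integral\<^sup>L M (f' a)) (at a)"
  proof (rule tendsto_integral_dominated[OF _ _ w])
    show "\<forall>\<^sub>F y in at a. \<forall>x\<in>space M. norm ((f y x - f a x) / (y - a)) \<le> w x"
      using near
    proof eventually_elim
      case (elim y)
      show ?case
      proof
        fix x assume x: "x \<in> space M"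
        have "norm (f y x - f a x) \<le> w x * norm (y - a)"
          by (rule field_differentiable_bound[of "ball a \<delta>" "\<lambda>y. f y x" "\<lambda>y. f' y x"])
             (use elim \<open>\<delta> > 0\<close> deriv[OF x] bound[OF x] in \<open>auto intro: has_field_derivative_at_within\<close>)
        then show "norm ((f y x - f a x) / (y - a)) \<le> w x"
          using elim by (simp add: norm_divide field_simps)
      qed
    qed
    show "((\<lambda>y. (f y x - f a x) / (y - a)) \<longlongrightarrow> f' a x) (at a)" if "x \<in> space M" for x
      using deriv[OF that, of a] \<open>\<delta> > 0\<close> by (simp add: has_field_derivative_iff)
  qed auto
  then show "((\<lambda>y. (integral\<^sup>L M (f y) - integral\<^sup>L M (f a)) / (y - a)) \<longlongrightarrow> integral\<^sup>L M (f' a)) (at a)"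
  proof (rule Lim_transform_eventually)
    show "\<forall>\<^sub>F y in at a. (\<integral>x. (f y x - f a x) / (y - a) \<partial>M) =
        (integral\<^sup>L M (f y) - integral\<^sup>L M (f a)) / (y - a)"
      using near by eventually_elim (use int \<open>\<delta> > 0\<close> in simp)
  qed
qed

text \<open>
  The half-line is a measure space of its own, so that positivity of the integration variable is
  available from membership in the space; omitting the point \<open>0\<close> does not change any integral.
\<close>

abbreviation halfline :: "real measure" where
  "halfline \<equiv> restrict_space lborel {0<..}"

lemma measurable_halfline [measurable]: "(\<lambda>x. x) \<in> borel_measurable halfline"
  by (simp add: measurable_restrict_space1)

lemma measurable_halflineI: "f \<in> borel_measurable borel \<Longrightarrow> f \<in> borel_measurable halfline"
  by (simp add: measurable_restrict_space1)

lemma space_halfline [simp]: "space halfline = {0<..}"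
  by (simp add: space_restrict_space)

lemma sigma_finite_halfline: "sigma_finite_measure halfline"
  by (intro sigma_finite_measure_restrict_space lborel.sigma_finite_measure_axioms) simp

lemma has_integral_halfline:
  fixes f :: "real \<Rightarrow> 'a::euclidean_space"
  assumes "integrable halfline f"
  shows "(f has_integral integral\<^sup>L halfline f) {0<..}"
proof -
  have "set_integrable lborel {0<..} f"
    using assms by (simp add: integrable_restrict_space set_integrable_def)
  from set_borel_integral_eq_integral[OF this] show ?thesis
    by (simp add: integral_restrict_space set_lebesgue_integral_def has_integral_integrable_integral)
qed

section \<open>The power series of the Bessel functions\<close>

text \<open>
  On a fixed ball of orders the numbers \<open>rGamma (\<nu> + m + 1)\<close> are bounded uniformly in \<open>m\<close>: for small
  \<open>m\<close> by compactness, and once \<open>norm (\<nu> + m + 1) \<ge> 1\<close> because \<open>rGamma (z + 1) = rGamma z / z\<close>.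
  This gives convergence of the Bessel series locally uniformly in the order.
\<close>

lemma rGamma_shift_bounded:
  fixes R :: real
  obtains C :: real where "C > 0"
    "\<And>m (\<nu>::'a::{Gamma,heine_borel}). norm \<nu> \<le> R \<Longrightarrow> norm (rGamma (\<nu> + of_nat m + 1)) \<le> C"
proof -
  define N where "N = nat \<lceil>R\<rceil>"
  have "compact ((\<lambda>z::'a. rGamma z) ` cball 0 (R + N + 1))"
    by (intro compact_continuous_image continuous_on_rGamma compact_cball)
  then obtain B where "B > 0" and B: "\<And>z::'a. norm z \<le> R + N + 1 \<Longrightarrow> norm (rGamma z) \<le> B"
    by (force dest!: compact_imp_bounded simp: bounded_pos)
  have "norm (rGamma (\<nu> + of_nat m + 1)) \<le> B" if "norm \<nu> \<le> R" for m and \<nu> :: 'a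
  proof (induction m)
    case 0
    have "norm (\<nu> + 1) \<le> R + N + 1"
      using norm_triangle_ineq[of \<nu> 1] that by simp
    then show ?case using B by simp
  next
    case (Suc m)
    show ?case
    proof (cases "Suc m \<le> N")
      case True
      have "norm (\<nu> + of_nat (Suc m) + 1) \<le> norm \<nu> + norm (of_nat (Suc m) :: 'a) + norm (1::'a)"
        by (intro order_trans[OF norm_triangle_ineq] add_mono order_refl)
      also have "\<dots> \<le> R + N + 1"
        using that True by (simp del: of_nat_Suc)
      finally show ?thesis by (rule B)
    next
      case False
      then have "real m \<ge> N" by simp
      moreover have "R \<le> N" unfolding N_def by linarith
      ultimately have "R \<le> m" by simp
      have "real m + 1 - norm \<nu> = norm (of_nat (Suc m) :: 'a) - norm (-\<nu>)"
        by (simp only: norm_of_nat) simp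
      also have "\<dots> \<le> norm (\<nu> + of_nat m + 1)"
        using norm_triangle_ineq2[of "of_nat (Suc m)" "- \<nu>"] by (simp add: add_ac)
      finally have ge: "1 \<le> norm (\<nu> + of_nat m + 1)"
        using \<open>R \<le> m\<close> that by linarith
      have "norm (rGamma (\<nu> + of_nat (Suc m) + 1)) \<le>
          norm (\<nu> + of_nat m + 1) * norm (rGamma (\<nu> + of_nat (Suc m) + 1))"
        using mult_right_mono[OF ge, of "norm (rGamma (\<nu> + of_nat (Suc m) + 1))"] by simp
      also have "\<dots> = norm (rGamma (\<nu> + of_nat m + 1))"
        using rGamma_plus1[of "\<nu> + of_nat m + 1"] by (simp add: norm_mult [symmetric] add_ac)
      finally show ?thesis using Suc by linarith
    qed
  qed
  with \<open>B > 0\<close> show thesis using that by blast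
qed

text \<open>
  The entire part of the Bessel functions: with \<open>w = z\<^sup>2 / 4\<close> it gives \<open>I\<^sub>\<nu>(z) = (z / 2) powr \<nu> * bessel_series \<nu> w\<close>,
  and with \<open>w = - (z\<^sup>2 / 4)\<close> likewise \<open>J\<^sub>\<nu>\<close>.  It satisfies simpler differentiation rules than \<open>I\<close> and \<open>J\<close>
  themselves.
\<close>

definition bessel_series :: "'a::Gamma \<Rightarrow> 'a \<Rightarrow> 'a" where
  "bessel_series \<nu> w = (\<Sum>m. rGamma (\<nu> + of_nat m + 1) / fact m * w ^ m)"

lemma summable_bessel_series:
  fixes \<nu> w :: "'a::{Gamma,heine_borel}"
  shows "summable (\<lambda>m. rGamma (\<nu> + of_nat m + 1) / fact m * w ^ m)"
proof -
  obtain C where C: "\<And>m. norm (rGamma (\<nu> + of_nat m + 1)) \<le> C"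
    using rGamma_shift_bounded[of "norm \<nu>"] by (metis order_refl)
  have "summable (\<lambda>m. C * (inverse (fact m) * norm w ^ m))"
    by (intro summable_mult summable_exp)
  then show ?thesis
  proof (rule summable_comparison_test')
    fix m :: nat
    have "norm (rGamma (\<nu> + of_nat m + 1)) * (norm w ^ m / fact m) \<le> C * (norm w ^ m / fact m)"
      by (intro mult_right_mono C) auto
    then show "norm (rGamma (\<nu> + of_nat m + 1) / fact m * w ^ m) \<le> C * (inverse (fact m) * norm w ^ m)"
      by (simp add: norm_mult norm_divide norm_power field_simps)
  qed
qed

lemma bessel_series_diffs:
  "diffs (\<lambda>m. rGamma (\<nu> + of_nat m + 1) / fact m) = (\<lambda>m. rGamma (\<nu> + 1 + of_nat m + 1) / fact m :: 'a::Gamma)"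
proof
  fix m
  have "\<nu> + of_nat (Suc m) + 1 = \<nu> + 1 + of_nat m + 1"
    by (simp add: algebra_simps)
  moreover have "of_nat (Suc m) \<noteq> (0 :: 'a)"
    using of_nat_neq_0 by blast
  ultimately show "diffs (\<lambda>m. rGamma (\<nu> + of_nat m + 1) / fact m) m =
      rGamma (\<nu> + 1 + of_nat m + 1) / (fact m :: 'a)"
    unfolding diffs_def fact_Suc by (simp del: of_nat_Suc)
qed

text \<open>
  Termwise differentiation only shifts the order.
\<close>

lemma has_field_derivative_bessel_series:
  fixes \<nu> w :: "'a::{Gamma,heine_borel}"
  shows "(bessel_series \<nu> has_field_derivative bessel_series (\<nu> + 1) w) (at w)"
  using termdiffs_strong_converges_everywhere[OF summable_bessel_series, of \<nu> w]
  by (simp add: bessel_series_def[abs_def] bessel_series_diffs)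

lemma bessel_series_deriv [derivative_intros]:
  fixes f :: "'a::{Gamma,heine_borel} \<Rightarrow> 'a"
  assumes "(f has_field_derivative f') (at w within A)" "D = bessel_series (\<nu> + 1) (f w) * f'"
  shows "((\<lambda>x. bessel_series \<nu> (f x)) has_field_derivative D) (at w within A)"
  unfolding assms(2) by (rule DERIV_chain2[OF has_field_derivative_bessel_series assms(1)])

lemma bessel_series_recurrence:
  fixes \<nu> w :: "'a::{Gamma,heine_borel}"
  shows "bessel_series (\<nu> - 1) w = \<nu> * bessel_series \<nu> w + w * bessel_series (\<nu> + 1) w"
proof -
  define c where "c = (\<lambda>m. rGamma (\<nu> + of_nat m + 1) / fact m)"
  have c: "(\<lambda>m. c m * w ^ m) sums bessel_series \<nu> w"
    unfolding c_def bessel_series_def by (intro summable_sums summable_bessel_series)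
  have "(\<lambda>m. diffs c m * w ^ m) sums bessel_series (\<nu> + 1) w"
    unfolding c_def bessel_series_diffs bessel_series_def by (intro summable_sums summable_bessel_series)
  from sums_mult[OF this, of w]
  have "(\<lambda>m. of_nat (Suc m) * c (Suc m) * w ^ Suc m) sums (w * bessel_series (\<nu> + 1) w)"
    by (simp add: diffs_def mult_ac)
  then have "(\<lambda>m. of_nat m * c m * w ^ m) sums (w * bessel_series (\<nu> + 1) w)"
    by (subst (asm) sums_Suc_iff) simp
  from sums_add[OF sums_mult[OF c, of \<nu>] this]
  have "(\<lambda>m. (\<nu> + of_nat m) * c m * w ^ m) sums (\<nu> * bessel_series \<nu> w + w * bessel_series (\<nu> + 1) w)"
    by (simp add: algebra_simps)
  moreover have "(\<nu> + of_nat m) * c m = rGamma (\<nu> - 1 + of_nat m + 1) / fact m" for m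
    using rGamma_plus1[of "\<nu> + of_nat m"] by (simp add: c_def)
  ultimately show ?thesis
    by (simp add: bessel_series_def sums_iff)
qed

lemma bessel_series_0 [simp]: "bessel_series \<nu> 0 = rGamma (\<nu> + 1)"
proof -
  have "(\<lambda>m. rGamma (\<nu> + of_nat m + 1) / fact m * 0 ^ m) sums rGamma (\<nu> + 1)"
    using powser_sums_zero[of "\<lambda>m. rGamma (\<nu> + of_nat m + 1) / fact m"] by simp
  then show ?thesis by (simp add: bessel_series_def sums_iff)
qed

lemma bessel_series_of_real:
  "bessel_series (complex_of_real \<nu>) (of_real w) = of_real (bessel_series \<nu> w)"
proof -
  have "rGamma (complex_of_real \<nu> + of_nat m + 1) / fact m * of_real w ^ m =
     of_real (rGamma (\<nu> + of_nat m + 1) / fact m * w ^ m)" for m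
  proof -
    have "complex_of_real \<nu> + of_nat m + 1 = of_real (\<nu> + of_nat m + 1)"
      by simp
    then show ?thesis
      by (simp only: rGamma_complex_of_real of_real_mult of_real_divide of_real_power of_real_fact)
  qed
  then show ?thesis
    unfolding bessel_series_def suminf_of_real[OF summable_bessel_series[of \<nu> w]]
    by (intro arg_cong[where f = suminf] ext)
qed

lemma Bessel_I_eq_bessel_series: "Bessel_I \<nu> z = (z / 2) powr \<nu> * bessel_series \<nu> (z\<^sup>2 / 4)"
  unfolding Bessel_I_def bessel_series_def ..

lemma Bessel_J_0_eq_bessel_series: "Bessel_J 0 x = bessel_series 0 (- (x / 2)\<^sup>2)"
proof -
  have "rGamma (0 + real m + 1) = inverse (fact m)" for m
    using Gamma_fact[of m, where ?'a = real] by (simp add: rGamma_inverse_Gamma add.commute)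
  moreover have "(- (x / 2)\<^sup>2) ^ m = (-1) ^ m * (x / 2) ^ (2 * m)" for m
    by (simp only: power_mult power_minus[of "(x / 2)\<^sup>2"])
  ultimately have "(-1) ^ m / (fact m * fact (m + 0)) * (x / 2) ^ (2 * m + 0) =
      rGamma (0 + real m + 1) / fact m * (- (x / 2)\<^sup>2) ^ m" for m
    by (simp only: add_0_right divide_inverse inverse_mult_distrib mult_ac)
  then show ?thesis
    unfolding Bessel_J_def bessel_series_def by (intro arg_cong[where f = suminf] ext)
qed

lemma bessel_series_pos:
  fixes \<nu> w :: real
  assumes "\<nu> > -1" "w \<ge> 0"
  shows "bessel_series \<nu> w > 0"
  unfolding bessel_series_def
proof (rule suminf_pos2[where i = 0, OF summable_bessel_series])
  have pos: "rGamma (\<nu> + real m + 1) > 0" for m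
    using Gamma_real_pos[of "\<nu> + real m + 1"] assms by (simp add: rGamma_inverse_Gamma)
  show "0 \<le> rGamma (\<nu> + real m + 1) / fact m * w ^ m" for m
    using pos[of m] assms by simp
  show "0 < rGamma (\<nu> + real 0 + 1) / fact 0 * w ^ 0"
    using pos[of 0] by simp
qed

lemma rGamma_1_2 [simp]: "rGamma (1::real) = 1" "rGamma (2::real) = 1"
  using rGamma_plus1[of "1::real"] by (simp_all add: rGamma_inverse_Gamma)

text \<open>
  The energy \<open>J\<^sub>0\<^sup>2 + J\<^sub>1\<^sup>2\<close> equals \<open>1\<close> at the origin and decreases on the positive axis, with
  derivative \<open>- 2 * J\<^sub>1\<^sup>2 / x\<close>.
\<close>

lemma abs_Bessel_J_0_le_1:
  assumes "x \<ge> 0"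
  shows "\<bar>Bessel_J 0 x\<bar> \<le> 1"
proof -
  \<comment> \<open>The second summand is the square of \<open>J\<^sub>1\<close>.\<close>
  define E where "E = (\<lambda>x::real. (bessel_series 0 (- (x / 2)\<^sup>2))\<^sup>2 + (x / 2 * bessel_series 1 (- (x / 2)\<^sup>2))\<^sup>2)"
  have "E x \<le> E 0"
  proof (rule DERIV_nonpos_imp_nonincreasing[OF assms])
    fix y :: real assume y: "0 \<le> y" "y \<le> x"
    let ?w = "- (y / 2)\<^sup>2"
    have rec: "bessel_series 0 ?w = bessel_series 1 ?w + ?w * bessel_series 2 ?w"
      using bessel_series_recurrence[of 1 ?w] by simp
    have "(E has_real_derivative - (y / 2) * (bessel_series 1 ?w)\<^sup>2) (at y)"
      unfolding E_def
      by (rule derivative_eq_intros refl | simp add: rec)+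
         (simp add: field_simps power2_eq_square)
    then show "\<exists>d. (E has_real_derivative d) (at y) \<and> d \<le> 0"
      using y by (intro exI conjI) (auto simp: mult_nonneg_nonneg)
  qed
  moreover have "E 0 = 1"
    by (simp add: E_def)
  moreover have "(Bessel_J 0 x)\<^sup>2 \<le> E x"
    by (simp add: E_def Bessel_J_0_eq_bessel_series)
  ultimately have "(Bessel_J 0 x)\<^sup>2 \<le> 1"
    by simp
  then show ?thesis
    by (simp add: abs_square_le_1)
qed

lemma Bessel_J_0_quadratic_drop:
  obtains \<delta> where "\<delta> > 0" "\<And>x. \<bar>x\<bar> < \<delta> \<Longrightarrow> x\<^sup>2 / 8 \<le> 1 - Bessel_J 0 x"
proof -
  have "((\<lambda>w::real. (bessel_series 0 w - 1) / w) \<longlongrightarrow> 1) (at 0)"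
    using has_field_derivative_bessel_series[of "0::real" 0] by (simp add: has_field_derivative_iff)
  then have "\<forall>\<^sub>F w in at 0. (bessel_series 0 w - 1) / w > (1/2 :: real)"
    by (rule order_tendstoD) simp
  then obtain d :: real where d: "d > 0" "\<And>w::real. w \<noteq> 0 \<Longrightarrow> \<bar>w\<bar> < d \<Longrightarrow> (bessel_series 0 w - 1) / w > 1/2"
    by (auto simp: eventually_at)
  show thesis
  proof (rule that[of "sqrt d"])
    fix x assume x: "\<bar>x\<bar> < sqrt d"
    show "x\<^sup>2 / 8 \<le> 1 - Bessel_J 0 x"
    proof (cases "x = 0")
      case False
      have "x\<^sup>2 < d"
        using x d(1) by (metis abs_ge_zero power2_abs real_sqrt_less_iff real_sqrt_abs)
      moreover have neg: "- (x / 2)\<^sup>2 < 0"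
        using False by simp
      ultimately have "1/2 < (bessel_series 0 (- (x / 2)\<^sup>2) - 1) / (- (x / 2)\<^sup>2)"
        using d(1) by (intro d(2)) (auto simp: power_divide)
      then have "bessel_series 0 (- (x / 2)\<^sup>2) - 1 < 1/2 * (- (x / 2)\<^sup>2)"
        by (subst (asm) neg_less_divide_eq[OF neg])
      then show ?thesis
        by (simp add: Bessel_J_0_eq_bessel_series power_divide)
    qed (simp add: Bessel_J_0_eq_bessel_series)
  qed (use d in simp)
qed

lemma continuous_on_Bessel_J_0: "continuous_on A (Bessel_J 0)"
  unfolding Bessel_J_0_eq_bessel_series[abs_def]
  by (rule DERIV_continuous_on) (rule derivative_eq_intros refl | simp)+

lemma Bessel_J_0_measurable [measurable]: "Bessel_J 0 \<in> borel_measurable borel"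
  by (intro borel_measurable_continuous_onI continuous_on_Bessel_J_0)

section \<open>An integral representation for orders between 0 and 1\<close>

text \<open>
  For \<open>x > 0\<close> this is \<open>2 * x powr (\<nu> / 2) * K\<^sub>\<nu>(2 * sqrt x)\<close>; the normalisation without the prefactor
  extends to \<open>x = 0\<close> when \<open>\<nu> > 0\<close>, where it becomes the Gamma integral.
\<close>

definition heat_integral :: "real \<Rightarrow> real \<Rightarrow> real" where
  "heat_integral \<nu> x = (\<integral>t. t powr (\<nu> - 1) * exp (- t - x / t) \<partial>halfline)"

lemma heat_kernel_measurable [measurable]: "(\<lambda>t. t powr (\<nu> - 1) * exp (- t - x / t)) \<in> borel_measurable halfline"
  by measurable

lemma Gamma_integral_halfline:
  assumes "\<nu> > 0"
  shows "integrable halfline (\<lambda>t. t powr (\<nu> - 1) * exp (- t))"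
    and "(\<integral>t. t powr (\<nu> - 1) * exp (- t) \<partial>halfline) = Gamma \<nu>"
proof -
  have eq: "(\<integral>\<^sup>+t. ennreal (t powr (\<nu> - 1) * exp (- t)) \<partial>halfline) = ennreal (Gamma \<nu>)"
  proof -
    have "ennreal (t powr (\<nu> - 1) * exp (- t)) * indicator {0<..} t =
        ennreal (indicator {0..} t * t powr (\<nu> - 1) / exp t)" for t
      by (cases t "0::real" rule: linorder_cases) (auto simp: exp_minus divide_inverse)
    then show ?thesis
      unfolding Gamma_conv_nn_integral_real[OF assms] by (subst nn_integral_restrict_space) auto
  qed
  show int: "integrable halfline (\<lambda>t. t powr (\<nu> - 1) * exp (- t))"
    by (rule integrableI_nn_integral_finite[OF _ _ eq]) auto
  show "(\<integral>t. t powr (\<nu> - 1) * exp (- t) \<partial>halfline) = Gamma \<nu>"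
    using eq Gamma_real_pos[OF assms]
    by (subst integral_eq_nn_integral) auto
qed

lemma heat_integral_0: "\<nu> > 0 \<Longrightarrow> heat_integral \<nu> 0 = Gamma \<nu>"
  using Gamma_integral_halfline(2) by (simp add: heat_integral_def)

text \<open>
  The factor \<open>exp (- x / t)\<close> compensates one power of \<open>1 / t\<close>, uniformly for \<open>x \<ge> c\<close>.
\<close>

lemma heat_kernel_le:
  fixes t c x :: real
  assumes "t > 0" "c > 0" "x \<ge> c"
  shows "t powr (\<nu> - 1) * exp (- t - x / t) \<le> 1 / c * (t powr \<nu> * exp (- t))"
proof -
  have "c / t \<le> exp (c / t)"
    using exp_ge_add_one_self[of "c / t"] by linarith
  then have "exp (- (c / t)) \<le> t / c"
    using assms by (simp add: exp_minus field_simps)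
  moreover have "exp (- (x / t)) \<le> exp (- (c / t))"
    using assms by (simp add: divide_right_mono)
  ultimately have "t powr (\<nu> - 1) * exp (- t) * exp (- (x / t)) \<le> t powr (\<nu> - 1) * exp (- t) * (t / c)"
    by (intro mult_left_mono order_trans[OF \<open>exp (- (x / t)) \<le> _\<close>]) auto
  also have "\<dots> = 1 / c * (t powr \<nu> * exp (- t))"
    using assms by (simp add: powr_diff)
  finally show ?thesis
    by (simp add: exp_diff exp_minus field_simps)
qed

lemma integrable_heat_kernel:
  assumes "\<nu> > -1" "x > 0"
  shows "integrable halfline (\<lambda>t. t powr (\<nu> - 1) * exp (- t - x / t))"
proof (rule Bochner_Integration.integrable_bound)
  show "integrable halfline (\<lambda>t. 1 / x * (t powr (\<nu> + 1 - 1) * exp (- t)))"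
    using Gamma_integral_halfline(1)[of "\<nu> + 1"] assms by auto
  show "AE t in halfline. norm (t powr (\<nu> - 1) * exp (- t - x / t)) \<le> norm (1 / x * (t powr (\<nu> + 1 - 1) * exp (- t)))"
    using heat_kernel_le[of _ x x \<nu>] assms by (intro AE_I2) auto
qed auto

lemma has_real_derivative_heat_integral:
  assumes "\<nu> > 0" "x > 0"
  shows "(heat_integral \<nu> has_real_derivative - heat_integral (\<nu> - 1) x) (at x)"
proof -
  define w where "w = (\<lambda>t. 1 / (x / 2) * (t powr (\<nu> - 1) * exp (- t)))"
  have "((\<lambda>y. \<integral>t. t powr (\<nu> - 1) * exp (- t - y / t) \<partial>halfline) has_field_derivative
      (\<integral>t. - (t powr (\<nu> - 1 - 1) * exp (- t - x / t)) \<partial>halfline)) (at x)"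
  proof (rule has_field_derivative_integral[where \<delta> = "x / 2" and w = w])
    fix y assume "y \<in> ball x (x / 2)"
    then have y: "y \<ge> x / 2" "y > 0"
      using assms by (auto simp: dist_real_def abs_if split: if_splits)
    show "integrable halfline (\<lambda>t. t powr (\<nu> - 1) * exp (- t - y / t))"
      using assms y by (intro integrable_heat_kernel) auto
    fix t assume "t \<in> space halfline"
    then have t: "t > 0" by simp
    show "((\<lambda>y. t powr (\<nu> - 1) * exp (- t - y / t)) has_real_derivative
        - (t powr (\<nu> - 1 - 1) * exp (- t - y / t))) (at y)"
      using t by (auto intro!: derivative_eq_intros simp: powr_diff field_simps power2_eq_square)
    show "norm (- (t powr (\<nu> - 1 - 1) * exp (- t - y / t))) \<le> w t"
      using heat_kernel_le[of t "x / 2" y "\<nu> - 1"] t assms y by (simp add: w_def)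
  next
    show "integrable halfline w"
      unfolding w_def using Gamma_integral_halfline(1)[OF assms(1)] by auto
  qed (use assms in auto)
  then show ?thesis
    by (simp add: heat_integral_def[abs_def])
qed

lemma continuous_on_heat_integral:
  assumes "\<nu> > 0"
  shows "continuous_on {0..} (heat_integral \<nu>)"
  unfolding continuous_on_def
proof
  fix x :: real assume "x \<in> {0..}"
  then have x: "x \<ge> 0" by simp
  show "(heat_integral \<nu> \<longlongrightarrow> heat_integral \<nu> x) (at x within {0..})"
    unfolding heat_integral_def[abs_def]
  proof (rule tendsto_integral_dominated[OF _ _ Gamma_integral_halfline(1)[OF assms]])
    show "\<forall>\<^sub>F y in at x within {0..}. \<forall>t\<in>space halfline.
        norm (t powr (\<nu> - 1) * exp (- t - y / t)) \<le> t powr (\<nu> - 1) * exp (- t)"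
      unfolding eventually_at_topological
      by (intro exI[of _ UNIV]) (auto intro!: mult_left_mono)
    show "((\<lambda>y. t powr (\<nu> - 1) * exp (- t - y / t)) \<longlongrightarrow> t powr (\<nu> - 1) * exp (- t - x / t)) (at x within {0..})"
      if "t \<in> space halfline" for t
      using that by (auto intro!: tendsto_eq_intros)
  qed auto
qed

text \<open>
  The substitution \<open>t \<mapsto> x / t\<close> exchanges the two terms of the exponent.
\<close>

lemma heat_integral_reflection:
  assumes "0 < \<nu>" "\<nu> < 1" "x > 0"
  shows "heat_integral (- \<nu>) x = x powr (- \<nu>) * heat_integral \<nu> x"
proof -
  let ?k = "\<lambda>\<nu> t. t powr (\<nu> - 1) * exp (- t - x / t)"
  let ?g = "\<lambda>t. \<bar>- x / t\<^sup>2\<bar> * ?k \<nu> (x / t)"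
  have int: "integrable halfline (?k \<nu>)" "integrable halfline (?k (- \<nu>))"
    using assms by (auto intro!: integrable_heat_kernel)
  have "(\<lambda>t. x / t) ` {0<..} = {0<..}"
  proof
    show "{0<..} \<subseteq> (\<lambda>t. x / t) ` {0<..}"
    proof
      fix y :: real assume "y \<in> {0<..}"
      then show "y \<in> (\<lambda>t. x / t) ` {0<..}"
        using assms by (intro image_eqI[of _ _ "x / y"]) auto
    qed
  qed (use assms in auto)
  moreover have "?k \<nu> absolutely_integrable_on {0<..}"
    using has_integral_halfline[OF int(1)]
    by (intro nonnegative_absolutely_integrable_1) auto
  moreover have "integral {0<..} (?k \<nu>) = heat_integral \<nu> x"
    using has_integral_halfline[OF int(1)] by (simp add: integral_unique heat_integral_def)
  moreover have "((\<lambda>t. x / t) has_real_derivative - x / t\<^sup>2) (at t within {0<..})" if "t \<in> {0<..}" for t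
    using that by (auto intro!: derivative_eq_intros simp: power2_eq_square)
  moreover have "inj_on (\<lambda>t. x / t) {0<..}"
    using assms by (auto intro!: inj_onI)
  ultimately have "integral {0<..} ?g = heat_integral \<nu> x"
    using has_absolute_integral_change_of_variables_1'
      [of "{0<..}" "\<lambda>t. x / t" "\<lambda>t. - x / t\<^sup>2" "?k \<nu>" "heat_integral \<nu> x"] by simp
  also have "integral {0<..} ?g = integral {0<..} (\<lambda>t. x powr \<nu> * ?k (- \<nu>) t)"
  proof (rule Henstock_Kurzweil_Integration.integral_cong)
    fix t :: real assume "t \<in> {0<..}"
    then show "?g t = x powr \<nu> * ?k (- \<nu>) t"
      using assms by (simp add: powr_diff powr_divide powr_minus field_simps power2_eq_square)
  qed
  also have "\<dots> = x powr \<nu> * heat_integral (- \<nu>) x"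
    using has_integral_halfline[OF int(2)] by (simp add: integral_unique heat_integral_def)
  finally show ?thesis
    using assms by (simp add: powr_minus field_simps)
qed

text \<open>
  Write \<open>g\<^sub>\<mu>\<close> for the heat integral.  By the reflection rule, \<open>g\<^sub>\<mu>\<close> and \<open>g\<^sub>1\<^sub>-\<^sub>\<mu>\<close> satisfy
  \<open>P' = - x powr (\<mu> - 1) * Q\<close> and \<open>Q' = - x powr (- \<mu>) * P\<close>, and the right-hand sides for the orders \<open>\<mu>\<close>
  and \<open>1 - \<mu>\<close> satisfy the same system.  The differences \<open>P\<close>, \<open>Q\<close> of the two pairs vanish at \<open>0\<close>.  The
  coefficients are singular there, so standard uniqueness does not apply; instead \<open>P\<close> is compared with a
  solution \<open>(p, q)\<close> whose first component is positive.
\<close>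

lemma heat_integral_eq_bessel_series:
  assumes \<mu>: "0 < \<mu>" "\<mu> < 1" and "x > 0"
  shows "heat_integral \<mu> x =
    pi / sin (pi * \<mu>) * (bessel_series (- \<mu>) x - x powr \<mu> * bessel_series \<mu> x)"
proof -
  define c where "c = (\<lambda>\<mu> x. pi / sin (pi * \<mu>) * (bessel_series (- \<mu>) x - x powr \<mu> * bessel_series \<mu> x) :: real)"
  define d where "d = (\<lambda>\<mu> x. heat_integral \<mu> x - c \<mu> x)"
  have sin_pos: "sin (pi * \<mu>) > 0" if "0 < \<mu>" "\<mu> < 1" for \<mu>
    using that by (intro sin_gt_zero) auto
  have d_deriv: "(d \<mu> has_real_derivative - (x powr (\<mu> - 1)) * d (1 - \<mu>) x) (at x)"
    if that: "0 < \<mu>" "\<mu> < 1" "0 < x" for \<mu> x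
  proof -
    have "heat_integral (\<mu> - 1) x = x powr (\<mu> - 1) * heat_integral (1 - \<mu>) x"
      using heat_integral_reflection[of "1 - \<mu>" x] that by simp
    then have 1: "(heat_integral \<mu> has_real_derivative - (x powr (\<mu> - 1) * heat_integral (1 - \<mu>) x)) (at x)"
      using has_real_derivative_heat_integral[of \<mu> x] that by simp
    have "bessel_series (\<mu> - 1) x = \<mu> * bessel_series \<mu> x + x * bessel_series (\<mu> + 1) x"
      by (rule bessel_series_recurrence)
    moreover have "x powr \<mu> = x * x powr (\<mu> - 1)"
      using that by (simp add: powr_diff)
    ultimately have "((\<lambda>x. bessel_series (- \<mu>) x - x powr \<mu> * bessel_series \<mu> x) has_real_derivative
        bessel_series (1 - \<mu>) x - x powr (\<mu> - 1) * bessel_series (\<mu> - 1) x) (at x)"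
      using that by (auto intro!: derivative_eq_intros simp: algebra_simps)
    from DERIV_cmult[OF this] have 2: "(c \<mu> has_real_derivative
        pi / sin (pi * \<mu>) * (bessel_series (1 - \<mu>) x - x powr (\<mu> - 1) * bessel_series (\<mu> - 1) x)) (at x)"
      unfolding c_def .
    have "sin (pi * (1 - \<mu>)) = sin (pi * \<mu>)"
      by (simp add: right_diff_distrib sin_diff)
    moreover have "x powr (\<mu> - 1) * x powr (1 - \<mu>) = 1"
      using that by (simp add: powr_add [symmetric])
    ultimately have "pi / sin (pi * \<mu>) * (bessel_series (1 - \<mu>) x - x powr (\<mu> - 1) * bessel_series (\<mu> - 1) x)
        = - (x powr (\<mu> - 1) * c (1 - \<mu>) x)"
      by (simp add: c_def algebra_simps)
    with 2 have "(c \<mu> has_real_derivative - (x powr (\<mu> - 1) * c (1 - \<mu>) x)) (at x)"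
      by simp
    from DERIV_diff[OF 1 this] show ?thesis
      by (simp add: d_def algebra_simps)
  qed
  have S_cont: "continuous_on {0..} (bessel_series \<nu>)" for \<nu> :: real
    by (intro DERIV_continuous_on[where D = "bessel_series (\<nu> + 1)"]
          has_field_derivative_at_within[OF has_field_derivative_bessel_series])
  have powr_cont: "continuous_on {0..} (\<lambda>x::real. x powr \<mu>)" if "\<mu> > 0" for \<mu>
    using that by (intro continuous_on_powr' continuous_intros) auto
  have c_cont: "continuous_on {0..} (c \<mu>)" if "0 < \<mu>" "\<mu> < 1" for \<mu>
    unfolding c_def using that sin_pos[OF that] by (intro continuous_intros S_cont powr_cont) auto
  have d_cont: "continuous_on {0..} (d \<mu>)" if "0 < \<mu>" "\<mu> < 1" for \<mu>
    unfolding d_def using that by (intro continuous_intros c_cont continuous_on_heat_integral) auto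
  have d_0: "d \<mu> 0 = 0" if "0 < \<mu>" "\<mu> < 1" for \<mu>
  proof -
    have eq: "complex_of_real (1 - \<mu>) = 1 - of_real \<mu>" "complex_of_real (pi * \<mu>) = of_real pi * of_real \<mu>"
      by simp_all
    have "complex_of_real (Gamma \<mu> * Gamma (1 - \<mu>)) = of_real (pi / sin (pi * \<mu>))"
      unfolding of_real_mult of_real_divide Gamma_complex_of_real [symmetric] sin_of_real [symmetric] eq
      by (rule Gamma_reflection_complex)
    then have "Gamma \<mu> * Gamma (1 - \<mu>) = pi / sin (pi * \<mu>)"
      by (rule of_real_eq_iff[THEN iffD1])
    moreover have "Gamma (1 - \<mu>) > 0"
      using that by (intro Gamma_real_pos) auto
    ultimately have "Gamma \<mu> = (pi / sin (pi * \<mu>)) / Gamma (1 - \<mu>)"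
      by (metis less_irrefl nonzero_eq_divide_eq)
    then have "Gamma \<mu> = pi / sin (pi * \<mu>) * rGamma (1 - \<mu>)"
      by (simp add: rGamma_inverse_Gamma divide_inverse)
    then show ?thesis
      using that by (simp add: d_def c_def heat_integral_0)
  qed
  \<comment> \<open>A solution of the system that stays bounded at \<open>0\<close>, with \<open>p(0) = 1 / Gamma (1 - \<mu>)\<close> and \<open>q(0) = 0\<close>.\<close>
  define p where "p = bessel_series (- \<mu>)"
  define q where "q = (\<lambda>x. - (x powr (1 - \<mu>)) * bessel_series (1 - \<mu>) x)"
  have p_deriv: "(p has_real_derivative - (y powr (\<mu> - 1)) * q y) (at y)" if "y > 0" for y
    using has_field_derivative_bessel_series[of "- \<mu>" y] that
    by (simp add: p_def q_def powr_add [symmetric] flip: mult.assoc)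
  have q_deriv: "(q has_real_derivative - (y powr (- \<mu>)) * p y) (at y)" if "y > 0" for y
  proof -
    have rec: "bessel_series (- \<mu>) y = (1 - \<mu>) * bessel_series (1 - \<mu>) y + y * bessel_series (1 - \<mu> + 1) y"
      using bessel_series_recurrence[of "1 - \<mu>" y] by simp
    have "y powr (1 - \<mu>) = y * y powr (- \<mu>)"
      using that by (simp add: powr_diff powr_minus field_simps)
    then show ?thesis
      unfolding q_def p_def rec using that
      by (auto intro!: derivative_eq_intros simp: algebra_simps)
  qed
  have p_pos: "p y > 0" if "y \<ge> 0" for y
    unfolding p_def using \<mu> that by (intro bessel_series_pos) auto
  have p_cont: "continuous_on {0..} p" and q_cont: "continuous_on {0..} q"
  proof -
    show "continuous_on {0..} p" unfolding p_def by (rule S_cont)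
    show "continuous_on {0..} q" unfolding q_def using \<mu> by (intro continuous_intros S_cont powr_cont) auto
  qed
  define P where "P = d \<mu>"
  define Q where "Q = d (1 - \<mu>)"
  have P_deriv: "(P has_real_derivative - (y powr (\<mu> - 1)) * Q y) (at y)"
    and Q_deriv: "(Q has_real_derivative - (y powr (- \<mu>)) * P y) (at y)" if "y > 0" for y
    using d_deriv[of \<mu> y] d_deriv[of "1 - \<mu>" y] that \<mu> by (simp_all add: P_def Q_def)
  have PQ_cont: "continuous_on {0..} P" "continuous_on {0..} Q"
    using d_cont \<mu> by (simp_all add: P_def Q_def)
  have PQ_0: "P 0 = 0" "Q 0 = 0"
    using d_0 \<mu> by (simp_all add: P_def Q_def)
  \<comment> \<open>The Wronskian of two solutions is constant, and this one vanishes at \<open>0\<close>.\<close>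
  have wronskian: "P y * q y = Q y * p y" if "y > 0" for y
  proof -
    have "P y * q y - Q y * p y = P 0 * q 0 - Q 0 * p 0"
    proof (rule DERIV_isconst_end[OF that])
      show "continuous_on {0..y} (\<lambda>y. P y * q y - Q y * p y)"
        using PQ_cont p_cont q_cont
        by (intro continuous_intros) (auto elim: continuous_on_subset)
      show "((\<lambda>y. P y * q y - Q y * p y) has_real_derivative 0) (at z)" if "0 < z" for z
        by (rule derivative_eq_intros P_deriv[OF that] Q_deriv[OF that] p_deriv[OF that] q_deriv[OF that] refl)+
           (simp add: algebra_simps)
    qed
    then show ?thesis using PQ_0 by simp
  qed
  \<comment> \<open>Vanishing of the Wronskian makes \<open>P\<close> a constant multiple of \<open>p\<close>.\<close>
  have "P x / p x = P 0 / p 0"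
  proof (rule DERIV_isconst_end[OF \<open>x > 0\<close>])
    show "continuous_on {0..x} (\<lambda>x. P x / p x)"
    proof (intro continuous_on_divide ballI)
      show "continuous_on {0..x} P" "continuous_on {0..x} p"
        by (rule continuous_on_subset[OF PQ_cont(1)] continuous_on_subset[OF p_cont]; auto)+
      show "p y \<noteq> 0" if "y \<in> {0..x}" for y
        using p_pos[of y] that by auto
    qed
    show "((\<lambda>x. P x / p x) has_real_derivative 0) (at y)" if "0 < y" for y
    proof -
      have "((\<lambda>x. P x / p x) has_real_derivative
          (- (y powr (\<mu> - 1)) * Q y * p y - P y * (- (y powr (\<mu> - 1)) * q y)) / (p y * p y)) (at y)"
        using p_pos[of y] that by (intro DERIV_divide P_deriv p_deriv) auto
      also have "- (y powr (\<mu> - 1)) * Q y * p y - P y * (- (y powr (\<mu> - 1)) * q y) =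
          y powr (\<mu> - 1) * (P y * q y - Q y * p y)"
        by (simp add: algebra_simps)
      also have "\<dots> = 0"
        by (simp add: wronskian[OF that])
      finally show ?thesis
        by simp
    qed
  qed
  then have "P x = 0"
    using PQ_0 p_pos[of x] \<open>x > 0\<close> by simp
  then show ?thesis
    by (simp add: P_def d_def c_def)
qed

section \<open>Modified Bessel functions of integer order\<close>

text \<open>
  The derivative of the Bessel series with respect to its order.
\<close>

definition bessel_series_dorder :: "complex \<Rightarrow> complex \<Rightarrow> complex" where
  "bessel_series_dorder \<nu> w = (\<Sum>m. deriv rGamma (\<nu> + of_nat m + 1) / fact m * w ^ m)"

text \<open>
  Locally uniform convergence of a series of holomorphic functions permits termwise differentiation,
  here with respect to the order.
\<close>

lemma bessel_series_dorder_sums: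
    "(\<lambda>m. deriv rGamma (\<nu> + of_nat m + 1) / fact m * w ^ m) sums bessel_series_dorder \<nu> w" (is ?sums)
  and has_field_derivative_bessel_series_order:
    "((\<lambda>\<nu>. bessel_series \<nu> w) has_field_derivative bessel_series_dorder \<nu> w) (at \<nu>)" (is ?deriv)
proof -
  let ?f = "\<lambda>m \<nu>. rGamma (\<nu> + of_nat m + 1) / fact m * w ^ m"
  let ?f' = "\<lambda>m \<nu>. deriv rGamma (\<nu> + of_nat m + 1) / fact m * w ^ m"
  have "\<exists>g g'. \<forall>\<nu>\<in>UNIV. ((\<lambda>m. ?f m \<nu>) sums g \<nu>) \<and> ((\<lambda>m. ?f' m \<nu>) sums g' \<nu>) \<and>
      (g has_field_derivative g' \<nu>) (at \<nu>)"
  proof (rule series_and_derivative_comparison_complex[OF open_UNIV])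
    fix m :: nat and \<nu> :: complex
    have "(rGamma has_field_derivative deriv rGamma (\<nu> + of_nat m + 1)) (at (\<nu> + of_nat m + 1))"
      by (intro field_differentiable_derivI field_differentiable_rGamma)
    then have "((\<lambda>\<nu>. rGamma (\<nu> + of_nat m + 1)) has_field_derivative deriv rGamma (\<nu> + of_nat m + 1)) (at \<nu>)"
      by (rule DERIV_chain2[THEN DERIV_cong]) (auto intro!: derivative_eq_intros)
    then show "((\<lambda>\<nu>. ?f m \<nu>) has_field_derivative ?f' m \<nu>) (at \<nu>)"
      by (intro DERIV_cmult_right DERIV_cdivide)
  next
    fix \<nu> :: complex
    obtain C where "C > 0" and C: "\<And>m \<mu>::complex. norm \<mu> \<le> norm \<nu> + 1 \<Longrightarrow> norm (rGamma (\<mu> + of_nat m + 1)) \<le> C"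
      using rGamma_shift_bounded[of "norm \<nu> + 1"] by metis
    define h where "h = (\<lambda>m. C * (inverse (fact m) * norm w ^ m))"
    have h_nonneg: "h m \<ge> 0" for m
      using \<open>C > 0\<close> by (simp add: h_def)
    show "\<exists>d h. 0 < d \<and> summable h \<and> range h \<subseteq> \<real>\<^sub>\<ge>\<^sub>0 \<and>
        (\<forall>\<^sub>F m in sequentially. \<forall>\<mu>\<in>ball \<nu> d \<inter> UNIV. cmod (?f m \<mu>) \<le> cmod (h m))"
    proof (intro exI[of _ 1] exI[of _ "\<lambda>m. complex_of_real (h m)"] conjI always_eventually allI ballI)
      show "summable (\<lambda>m. complex_of_real (h m))"
        unfolding h_def by (intro summable_of_real summable_mult summable_exp)
      show "range (\<lambda>m. complex_of_real (h m)) \<subseteq> \<real>\<^sub>\<ge>\<^sub>0"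
        using h_nonneg by auto
      fix m \<mu> assume "\<mu> \<in> ball \<nu> 1 \<inter> UNIV"
      then have "norm (\<mu> - \<nu>) < 1"
        by (simp add: dist_norm norm_minus_commute)
      then have "norm \<mu> \<le> norm \<nu> + 1"
        using norm_triangle_ineq[of \<nu> "\<mu> - \<nu>"] by simp
      from mult_right_mono[OF C[OF this, of m], of "norm w ^ m / fact m"]
      show "cmod (?f m \<mu>) \<le> cmod (complex_of_real (h m))"
        using h_nonneg[of m] \<open>C > 0\<close> by (simp add: norm_mult norm_divide norm_power h_def field_simps)
    qed simp
  qed
  then obtain g g' where g: "\<And>\<nu>. (\<lambda>m. ?f m \<nu>) sums g \<nu>" "\<And>\<nu>. (\<lambda>m. ?f' m \<nu>) sums g' \<nu>"
      "\<And>\<nu>. (g has_field_derivative g' \<nu>) (at \<nu>)"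
    by auto
  have "g = (\<lambda>\<nu>. bessel_series \<nu> w)" "g' = (\<lambda>\<nu>. bessel_series_dorder \<nu> w)"
    using g(1,2) by (auto simp: bessel_series_def bessel_series_dorder_def sums_iff)
  with g show ?sums ?deriv by auto
qed

lemma holomorphic_bessel_series: "bessel_series \<nu> holomorphic_on A"
  using has_field_derivative_bessel_series
  by (auto simp: holomorphic_on_def field_differentiable_def intro: has_field_derivative_at_within)

lemma holomorphic_bessel_series_dorder: "bessel_series_dorder \<nu> holomorphic_on A"
proof -
  have "\<exists>D. (bessel_series_dorder \<nu> has_field_derivative D) (at w within A)" for w
    using termdiffs_strong_converges_everywhere[OF sums_summable[OF bessel_series_dorder_sums], of \<nu> w]
    unfolding bessel_series_dorder_def [symmetric] by (blast intro: has_field_derivative_at_within)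
  then show ?thesis
    by (auto simp: holomorphic_on_def field_differentiable_def)
qed

lemma has_field_derivative_Bessel_I_order:
  assumes "z \<noteq> 0"
  shows "((\<lambda>\<nu>. Bessel_I \<nu> z) has_field_derivative
    (z / 2) powr \<nu> * (Ln (z / 2) * bessel_series \<nu> (z\<^sup>2 / 4) + bessel_series_dorder \<nu> (z\<^sup>2 / 4))) (at \<nu>)"
proof -
  have "((\<lambda>\<nu>. (z / 2) powr \<nu>) has_field_derivative Ln (z / 2) * (z / 2) powr \<nu>) (at \<nu>)"
    using assms has_field_derivative_powr_right[of "z / 2" \<nu>] by simp
  from DERIV_mult[OF this has_field_derivative_bessel_series_order[where w = "z\<^sup>2 / 4"]] show ?thesis
    by (simp add: Bessel_I_eq_bessel_series algebra_simps)
qed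

text \<open>
  At an integer order numerator and denominator of the defining quotient both vanish, and its limit is
  the quotient of their derivatives in the order.
\<close>

lemma Bessel_K_quotient_tendsto:
  assumes "\<nu> \<in> \<int>" and I_eq: "Bessel_I (- \<nu>) z = Bessel_I \<nu> z" and "z \<noteq> 0"
    and I': "((\<lambda>\<mu>. Bessel_I (- \<mu>) z - Bessel_I \<mu> z) has_field_derivative D) (at \<nu>)"
  shows "((\<lambda>\<mu>. Bessel_K_quotient \<mu> z) \<longlongrightarrow> D / (2 * cos (\<nu> * pi))) (at \<nu>)"
    and "Bessel_K \<nu> z = D / (2 * cos (\<nu> * pi))"
proof -
  obtain n :: int where n: "\<nu> = of_int n"
    using assms(1) by (elim Ints_cases)
  have "sin (\<nu> * pi) = of_real (sin (of_int n * pi))"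
    unfolding n by (simp flip: sin_of_real)
  then have sin_0: "sin (\<nu> * pi) = 0"
    by (simp add: mult.commute)
  then have "cos (\<nu> * pi) \<noteq> 0"
    using sin_cos_squared_add[of "\<nu> * pi"] by auto
  have "((\<lambda>\<mu>. sin (\<mu> * pi)) has_field_derivative cos (\<nu> * pi) * pi) (at \<nu>)"
    by (auto intro!: derivative_eq_intros)
  then have "((\<lambda>\<mu>. sin (\<mu> * pi) / (\<mu> - \<nu>)) \<longlongrightarrow> cos (\<nu> * pi) * pi) (at \<nu>)"
    using sin_0 by (simp add: has_field_derivative_iff)
  moreover have "((\<lambda>\<mu>. (Bessel_I (- \<mu>) z - Bessel_I \<mu> z) / (\<mu> - \<nu>)) \<longlongrightarrow> D) (at \<nu>)"
    using I' I_eq by (simp add: has_field_derivative_iff)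
  ultimately have "((\<lambda>\<mu>. of_real pi / 2 * (((Bessel_I (- \<mu>) z - Bessel_I \<mu> z) / (\<mu> - \<nu>)) / (sin (\<mu> * pi) / (\<mu> - \<nu>))))
      \<longlongrightarrow> of_real pi / 2 * (D / (cos (\<nu> * pi) * pi))) (at \<nu>)"
    using \<open>cos (\<nu> * pi) \<noteq> 0\<close> by (intro tendsto_intros) auto
  then show lim: "((\<lambda>\<mu>. Bessel_K_quotient \<mu> z) \<longlongrightarrow> D / (2 * cos (\<nu> * pi))) (at \<nu>)"
    by (rule Lim_transform_eventually[THEN tendsto_eq_rhs])
       (auto simp: eventually_at Bessel_K_quotient_def intro!: exI[of _ 1])
  then show "Bessel_K \<nu> z = D / (2 * cos (\<nu> * pi))"
    unfolding Bessel_K_def using assms(1) by (simp add: tendsto_Lim)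
qed

lemma DERIV_compose_uminus:
  assumes "(f has_field_derivative D) (at (- x))"
  shows "((\<lambda>x. f (- x)) has_field_derivative - D) (at x)"
  using DERIV_chain2[OF assms DERIV_minus[OF DERIV_ident]] by simp

text \<open>
  The explicit form makes \<open>K\<^sub>0\<close> visibly holomorphic in \<open>z\<close>, with the logarithm as the only source of a
  branch cut.
\<close>

lemma Bessel_K_0_eq:
  assumes "z \<noteq> 0"
  shows "Bessel_K 0 z = - (Ln (z / 2) * bessel_series 0 (z\<^sup>2 / 4) + bessel_series_dorder 0 (z\<^sup>2 / 4))"
    and "((\<lambda>\<mu>. Bessel_K_quotient \<mu> z) \<longlongrightarrow> Bessel_K 0 z) (at 0)"
proof -
  define D where "D = Ln (z / 2) * bessel_series 0 (z\<^sup>2 / 4) + bessel_series_dorder 0 (z\<^sup>2 / 4)"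
  have I': "((\<lambda>\<nu>. Bessel_I \<nu> z) has_field_derivative D) (at 0)"
    using has_field_derivative_Bessel_I_order[OF assms, of 0] assms by (simp add: D_def)
  then have "((\<lambda>\<nu>. Bessel_I (- \<nu>) z) has_field_derivative - D) (at 0)"
    using DERIV_compose_uminus[of "\<lambda>\<nu>. Bessel_I \<nu> z" D 0] by simp
  from DERIV_diff[OF this I']
  have "((\<lambda>\<mu>. Bessel_I (- \<mu>) z - Bessel_I \<mu> z) has_field_derivative - 2 * D) (at 0)"
    by simp
  from Bessel_K_quotient_tendsto[OF _ _ assms this]
  have "Bessel_K 0 z = - D" "((\<lambda>\<mu>. Bessel_K_quotient \<mu> z) \<longlongrightarrow> - D) (at 0)"
    by simp_all
  then show "Bessel_K 0 z = - (Ln (z / 2) * bessel_series 0 (z\<^sup>2 / 4) + bessel_series_dorder 0 (z\<^sup>2 / 4))"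
    and "((\<lambda>\<mu>. Bessel_K_quotient \<mu> z) \<longlongrightarrow> Bessel_K 0 z) (at 0)"
    by (simp_all add: D_def)
qed

lemma holomorphic_Bessel_K_0:
  assumes "A \<inter> \<real>\<^sub>\<le>\<^sub>0 = {}"
  shows "Bessel_K 0 holomorphic_on A"
proof -
  have "(\<lambda>z. z\<^sup>2 / 4) holomorphic_on A"
    by (intro holomorphic_intros) auto
  from holomorphic_on_compose[OF this holomorphic_bessel_series[of 0]]
    holomorphic_on_compose[OF this holomorphic_bessel_series_dorder[of 0]]
  have *: "(\<lambda>z. bessel_series 0 (z\<^sup>2 / 4)) holomorphic_on A" "(\<lambda>z. bessel_series_dorder 0 (z\<^sup>2 / 4)) holomorphic_on A"
    by (simp_all add: o_def)
  have "z / 2 \<notin> \<real>\<^sub>\<le>\<^sub>0" if "z \<in> A" for z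
    using assms that by (auto simp: complex_nonpos_Reals_iff)
  then have "(\<lambda>z. - (Ln (z / 2) * bessel_series 0 (z\<^sup>2 / 4) + bessel_series_dorder 0 (z\<^sup>2 / 4))) holomorphic_on A"
    by (intro holomorphic_intros *) auto
  then show ?thesis
  proof (rule holomorphic_transform)
    fix z assume "z \<in> A"
    then have "z \<noteq> 0"
      using assms by auto
    then show "- (Ln (z / 2) * bessel_series 0 (z\<^sup>2 / 4) + bessel_series_dorder 0 (z\<^sup>2 / 4)) = Bessel_K 0 z"
      by (simp add: Bessel_K_0_eq(1))
  qed
qed

lemma Bessel_K_quotient_minus_order: "Bessel_K_quotient (- \<mu>) z = Bessel_K_quotient \<mu> z"
proof -
  have "of_real pi / 2 * (Bessel_I \<mu> z - Bessel_I (- \<mu>) z) = - (of_real pi / 2 * (Bessel_I (- \<mu>) z - Bessel_I \<mu> z))"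
    by (simp only: mult_minus_right [symmetric] minus_diff_eq)
  then show ?thesis
    by (simp only: Bessel_K_quotient_def minus_minus mult_minus_left sin_minus minus_divide_divide)
qed

text \<open>
  The bridge between the defining quotient and the heat integral: with \<open>x\<^sup>2 / 4\<close> as argument, the
  bracket in \<open>heat_integral_eq_bessel_series\<close> is \<open>(x / 2) powr \<mu>\<close> times \<open>I\<^sub>-\<^sub>\<mu>(x) - I\<^sub>\<mu>(x)\<close>.
\<close>

lemma Bessel_K_quotient_real:
  assumes "0 < \<mu>" "\<mu> < 1" "x > 0"
  shows "Bessel_K_quotient (of_real \<mu>) (of_real x) =
    of_real ((x / 2) powr (- \<mu>) * heat_integral \<mu> (x\<^sup>2 / 4) / 2)"
proof -
  have I: "Bessel_I (of_real \<nu>) (of_real x) = of_real ((x / 2) powr \<nu> * bessel_series \<nu> (x\<^sup>2 / 4))" for \<nu>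
  proof -
    have eq: "of_real x / 2 = complex_of_real (x / 2)" "(of_real x)\<^sup>2 / 4 = complex_of_real (x\<^sup>2 / 4)"
      by simp_all
    show ?thesis
      unfolding Bessel_I_eq_bessel_series eq bessel_series_of_real
      using assms by (subst powr_of_real) auto
  qed
  have sin_eq: "sin (of_real \<mu> * complex_of_real pi) = of_real (sin (pi * \<mu>))"
    by (simp add: mult.commute flip: sin_of_real)
  have Im: "Bessel_I (- of_real \<mu>) (of_real x) = of_real ((x / 2) powr (- \<mu>) * bessel_series (- \<mu>) (x\<^sup>2 / 4))"
    using I[of "- \<mu>"] by simp
  have "Bessel_K_quotient (of_real \<mu>) (of_real x) =
      of_real (pi / 2 * ((x / 2) powr (- \<mu>) * bessel_series (- \<mu>) (x\<^sup>2 / 4)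
        - (x / 2) powr \<mu> * bessel_series \<mu> (x\<^sup>2 / 4)) / sin (pi * \<mu>))"
    unfolding Bessel_K_quotient_def I Im sin_eq by simp
  moreover have "(x / 2) powr (- \<mu>) * (x\<^sup>2 / 4) powr \<mu> = (x / 2) powr \<mu>"
  proof -
    have "x\<^sup>2 / 4 = (x / 2) * (x / 2)"
      by (simp add: power2_eq_square)
    then have "(x\<^sup>2 / 4) powr \<mu> = (x / 2) powr \<mu> * (x / 2) powr \<mu>"
      using assms by (simp only: powr_mult)
    then show ?thesis
      using assms by (simp add: powr_minus)
  qed
  then have "(x / 2) powr \<mu> * bessel_series \<mu> (x\<^sup>2 / 4) =
      (x / 2) powr (- \<mu>) * ((x\<^sup>2 / 4) powr \<mu> * bessel_series \<mu> (x\<^sup>2 / 4))"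
    by (simp only: mult.assoc [symmetric])
  ultimately show ?thesis
    using heat_integral_eq_bessel_series[of \<mu> "x\<^sup>2 / 4"] assms
    by (simp only: right_diff_distrib [symmetric]) (simp add: mult_ac)
qed

lemma heat_integral_tendsto_order:
  assumes "x > 0" "0 \<le> \<nu>0" "\<nu>0 \<le> 1"
  shows "((\<lambda>\<nu>. heat_integral \<nu> x) \<longlongrightarrow> heat_integral \<nu>0 x) (at \<nu>0 within {0<..<1})"
  unfolding heat_integral_def
proof (rule tendsto_integral_dominated)
  show "integrable halfline (\<lambda>t. 1 / x * (t powr (1 - 1) * exp (- t) + t powr (2 - 1) * exp (- t)))"
    by (intro integrable_mult_right Bochner_Integration.integrable_add Gamma_integral_halfline(1)) auto
  show "\<forall>\<^sub>F \<nu> in at \<nu>0 within {0<..<1}. \<forall>t\<in>space halfline. norm (t powr (\<nu> - 1) * exp (- t - x / t)) \<le>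
      1 / x * (t powr (1 - 1) * exp (- t) + t powr (2 - 1) * exp (- t))"
    unfolding eventually_at_topological
  proof (intro exI[of _ UNIV] conjI ballI impI)
    fix \<nu> t :: real assume \<nu>: "\<nu> \<in> {0<..<1}" and "t \<in> space halfline"
    then have t: "t > 0" by simp
    have "t powr \<nu> \<le> 1 + t"
    proof (cases "t \<ge> 1")
      case True
      then have "t powr \<nu> \<le> t powr 1"
        using \<nu> by (intro powr_mono) auto
      then show ?thesis using True by simp
    next
      case False
      then have "t powr \<nu> \<le> 1"
        using \<nu> t by (intro powr_le1) auto
      then show ?thesis using t by simp
    qed
    then have "1 / x * (t powr \<nu> * exp (- t)) \<le> 1 / x * ((1 + t) * exp (- t))"
      using assms by (intro mult_left_mono mult_right_mono) auto
    also have "(1 + t) * exp (- t) = t powr (1 - 1) * exp (- t) + t powr (2 - 1) * exp (- t)"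
      using t by (simp add: algebra_simps)
    finally show "norm (t powr (\<nu> - 1) * exp (- t - x / t)) \<le>
        1 / x * (t powr (1 - 1) * exp (- t) + t powr (2 - 1) * exp (- t))"
      using heat_kernel_le[of t x x \<nu>] t assms by simp
  qed auto
  show "((\<lambda>\<nu>. t powr (\<nu> - 1) * exp (- t - x / t)) \<longlongrightarrow> t powr (\<nu>0 - 1) * exp (- t - x / t)) (at \<nu>0 within {0<..<1})"
    if "t \<in> space halfline" for t
    using that by (auto intro!: tendsto_intros)
qed auto

lemma Bessel_K_0_real:
  assumes "x > 0"
  shows "Bessel_K 0 (of_real x) = of_real (heat_integral 0 (x\<^sup>2 / 4) / 2)"
proof (rule tendsto_unique)
  let ?F = "at (0::real) within {0<..<1}"
  show "?F \<noteq> bot"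
    by (simp add: trivial_limit_within islimpt_greaterThanLessThan1)
  have "filterlim complex_of_real (at 0) ?F"
    by (auto simp: filterlim_at eventually_at_topological intro!: tendsto_eq_intros exI[of _ UNIV])
  from filterlim_compose[OF Bessel_K_0_eq(2) this, of "of_real x"]
  show "((\<lambda>\<mu>. Bessel_K_quotient (of_real \<mu>) (of_real x)) \<longlongrightarrow> Bessel_K 0 (of_real x)) ?F"
    using assms by simp
  have "((\<lambda>\<mu>. complex_of_real ((x / 2) powr (- \<mu>) * heat_integral \<mu> (x\<^sup>2 / 4) / 2))
      \<longlongrightarrow> of_real ((x / 2) powr (- 0) * heat_integral 0 (x\<^sup>2 / 4) / 2)) ?F"
    using assms by (intro tendsto_intros heat_integral_tendsto_order) auto
  then show "((\<lambda>\<mu>. Bessel_K_quotient (of_real \<mu>) (of_real x)) \<longlongrightarrow> of_real (heat_integral 0 (x\<^sup>2 / 4) / 2)) ?F"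
  proof (rule Lim_transform_eventually[THEN tendsto_eq_rhs])
    show "\<forall>\<^sub>F \<mu> in ?F. complex_of_real ((x / 2) powr (- \<mu>) * heat_integral \<mu> (x\<^sup>2 / 4) / 2) =
        Bessel_K_quotient (of_real \<mu>) (of_real x)"
      unfolding eventually_at_topological
      using assms by (intro exI[of _ UNIV]) (auto simp: Bessel_K_quotient_real)
  qed (use assms in simp)
qed

text \<open>
  The order \<open>-1\<close> is approached along \<open>- \<mu>\<close> with \<open>\<mu> < 1\<close>, where evenness in the order brings the
  quotient into the range of the integral representation.
\<close>

lemma Bessel_K_minus_1_real:
  assumes "x > 0"
  shows "Bessel_K (-1) (of_real x) = of_real (heat_integral 1 (x\<^sup>2 / 4) / x)"
proof (rule tendsto_unique)
  let ?F = "at (1::real) within {0<..<1}"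
  let ?z = "complex_of_real x"
  show "?F \<noteq> bot"
    by (simp add: trivial_limit_within islimpt_greaterThanLessThan2)
  have "((\<lambda>\<mu>. Bessel_K_quotient \<mu> ?z) \<longlongrightarrow> Bessel_K (-1) ?z) (at (-1))"
  proof -
    \<comment> \<open>The recurrence at order \<open>0\<close> reads \<open>bessel_series (-1) w = w * bessel_series 1 w\<close>.\<close>
    have "Bessel_I (- (-1)) ?z = Bessel_I (-1) ?z"
      using bessel_series_recurrence[of 0 "?z\<^sup>2 / 4"] assms
      by (simp add: Bessel_I_eq_bessel_series powr_minus field_simps power2_eq_square)
    moreover obtain D where "((\<lambda>\<mu>. Bessel_I (- \<mu>) ?z - Bessel_I \<mu> ?z) has_field_derivative D) (at (-1))"
      using DERIV_diff[OF DERIV_compose_uminus[OF has_field_derivative_Bessel_I_order[of ?z "- (-1)"]]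
          has_field_derivative_Bessel_I_order[of ?z "-1"]] assms by auto
    ultimately show ?thesis
      using Bessel_K_quotient_tendsto[of "-1" ?z D] assms by simp
  qed
  moreover have "filterlim (\<lambda>\<mu>. - complex_of_real \<mu>) (at (-1)) ?F"
    by (auto simp: filterlim_at eventually_at_topological intro!: tendsto_eq_intros exI[of _ UNIV])
  ultimately show "((\<lambda>\<mu>. Bessel_K_quotient (- of_real \<mu>) ?z) \<longlongrightarrow> Bessel_K (-1) ?z) ?F"
    by (rule filterlim_compose)
  have "((\<lambda>\<mu>. complex_of_real ((x / 2) powr (- \<mu>) * heat_integral \<mu> (x\<^sup>2 / 4) / 2))
      \<longlongrightarrow> of_real ((x / 2) powr (- 1) * heat_integral 1 (x\<^sup>2 / 4) / 2)) ?F"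
    using assms by (intro tendsto_intros heat_integral_tendsto_order) auto
  then show "((\<lambda>\<mu>. Bessel_K_quotient (- of_real \<mu>) ?z) \<longlongrightarrow> of_real (heat_integral 1 (x\<^sup>2 / 4) / x)) ?F"
  proof (rule Lim_transform_eventually[THEN tendsto_eq_rhs])
    show "\<forall>\<^sub>F \<mu> in ?F. complex_of_real ((x / 2) powr (- \<mu>) * heat_integral \<mu> (x\<^sup>2 / 4) / 2) =
        Bessel_K_quotient (- of_real \<mu>) ?z"
      unfolding eventually_at_topological
      using assms by (intro exI[of _ UNIV]) (auto simp: Bessel_K_quotient_minus_order Bessel_K_quotient_real)
  qed (use assms in \<open>simp add: powr_minus\<close>)
qed

section \<open>Hankel transforms of Gaussians and their mixtures\<close>

text \<open>
  The standard Gaussian moment, rescaled by \<open>sqrt t\<close>.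
\<close>

lemma gaussian_odd_moment_halfline:
  assumes "t > 0"
  shows "has_bochner_integral halfline (\<lambda>k. k ^ (2 * m + 1) * exp (- t * k\<^sup>2)) (fact m / (2 * t ^ (m + 1)))"
proof -
  define s where "s = sqrt t"
  have s: "s > 0" "s\<^sup>2 = t"
    using assms by (auto simp: s_def)
  have "has_bochner_integral lborel
      (\<lambda>k. indicator {0..} (0 + s * k) *\<^sub>R (exp (- (0 + s * k)\<^sup>2) * (0 + s * k) ^ (2 * m + 1))) ((fact m / 2) /\<^sub>R \<bar>s\<bar>)"
    using gaussian_moment_odd_pos[of m] s
    by (subst (asm) lborel_has_bochner_integral_real_affine_iff[of s _ _ 0]) auto
  then have "has_bochner_integral lborel
      (\<lambda>k. (indicator {0..} (0 + s * k) *\<^sub>R (exp (- (0 + s * k)\<^sup>2) * (0 + s * k) ^ (2 * m + 1))) * (1 / s ^ (2 * m + 1)))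
      ((fact m / 2) /\<^sub>R \<bar>s\<bar> * (1 / s ^ (2 * m + 1)))"
    by (rule has_bochner_integral_mult_left)
  also have "(\<lambda>k. (indicator {0..} (0 + s * k) *\<^sub>R (exp (- (0 + s * k)\<^sup>2) * (0 + s * k) ^ (2 * m + 1))) * (1 / s ^ (2 * m + 1))) =
      (\<lambda>k. indicator {0<..} k *\<^sub>R (k ^ (2 * m + 1) * exp (- t * k\<^sup>2)))"
  proof
    fix k :: real
    consider "k < 0" | "k = 0" | "k > 0"
      by linarith
    then show "(indicator {0..} (0 + s * k) *\<^sub>R (exp (- (0 + s * k)\<^sup>2) * (0 + s * k) ^ (2 * m + 1))) * (1 / s ^ (2 * m + 1)) =
        indicator {0<..} k *\<^sub>R (k ^ (2 * m + 1) * exp (- t * k\<^sup>2))"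
    proof cases
      case 1
      then have "s * k < 0"
        using s by (simp add: mult_pos_neg)
      then show ?thesis using 1 by (simp add: indicator_def)
    next
      case 3
      then have "s * k > 0"
        using s by simp
      have "exp (- (s * k)\<^sup>2) * (s * k) ^ (2 * m + 1) * (1 / s ^ (2 * m + 1)) =
          exp (- (s\<^sup>2 * k\<^sup>2)) * k ^ (2 * m + 1) * (s ^ (2 * m + 1) * (1 / s ^ (2 * m + 1)))"
        by (simp only: power_mult_distrib mult_ac)
      also have "\<dots> = k ^ (2 * m + 1) * exp (- t * k\<^sup>2)"
        using s by simp
      finally show ?thesis
        using 3 \<open>s * k > 0\<close> by (simp only: indicator_def) simp
    qed simp
  qed
  also have "(fact m / 2) /\<^sub>R \<bar>s\<bar> * (1 / s ^ (2 * m + 1)) = fact m / (2 * t ^ (m + 1))"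
  proof -
    have "s * s ^ (2 * m + 1) = s ^ (2 * (m + 1))"
      by simp
    also have "\<dots> = t ^ (m + 1)"
      by (simp only: power_mult s(2))
    finally have "t ^ (m + 1) = s * s ^ (2 * m + 1)" ..
    moreover have "\<bar>s\<bar> = s"
      using s(1) by simp
    ultimately show ?thesis
      by (simp only: real_scaleR_def divide_inverse inverse_mult_distrib mult_ac mult_1)
  qed
  finally show ?thesis
    by (subst has_bochner_integral_restrict_space) simp_all
qed

lemma Bessel_J_0_sums: "(\<lambda>m. (- ((x / 2)\<^sup>2)) ^ m / (fact m)\<^sup>2) sums Bessel_J 0 x"
proof -
  have "rGamma (0 + real m + 1) = inverse (fact m)" for m
    using Gamma_fact[of m, where ?'a = real] by (simp add: rGamma_inverse_Gamma add.commute)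
  then have "rGamma (0 + real m + 1) / fact m * (- (x / 2)\<^sup>2) ^ m = (- ((x / 2)\<^sup>2)) ^ m / (fact m)\<^sup>2" for m
    by (simp only: divide_inverse power2_eq_square inverse_mult_distrib mult_ac)
  then show ?thesis
    using summable_sums[OF summable_bessel_series[of 0 "- (x / 2)\<^sup>2"]]
    by (simp only: Bessel_J_0_eq_bessel_series bessel_series_def)
qed

text \<open>
  Integrating the power series of \<open>J\<^sub>0\<close> termwise, the factorial in the odd moments cancels one of the
  two in the coefficients and leaves an exponential series.
\<close>

lemma hankel_transform_gaussian:
  assumes "t > 0"
  shows "(\<integral>k. k * Bessel_J 0 (k * h) * exp (- t * k\<^sup>2) \<partial>halfline) = exp (- (h\<^sup>2 / (4 * t))) / (2 * t)"
proof -
  \<comment> \<open>The \<open>m\<close>-th term integrates to \<open>c m\<close> times an odd Gaussian moment.  Its absolute value (\<open>pos\<close>) and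
    its signed value (\<open>alt\<close>) are both terms of exponential series.\<close>
  define c where "c = (\<lambda>m. (- ((h / 2)\<^sup>2)) ^ m / (fact m)\<^sup>2)"
  define f where "f = (\<lambda>m k. c m * (k ^ (2 * m + 1) * exp (- t * k\<^sup>2)))"
  have pos: "\<bar>c m\<bar> * (fact m / (2 * t ^ (m + 1))) = 1 / (2 * t) * (inverse (fact m) * (h\<^sup>2 / (4 * t)) ^ m)"
    and alt: "c m * (fact m / (2 * t ^ (m + 1))) = 1 / (2 * t) * (inverse (fact m) * (- (h\<^sup>2 / (4 * t))) ^ m)" for m
  proof -
    have *: "y ^ m / (fact m)\<^sup>2 * (fact m / (2 * t ^ (m + 1))) = 1 / (2 * t) * (inverse (fact m) * (y / t) ^ m)" for y
    proof -
      have "Y / F\<^sup>2 * (F / (2 * (t * T))) = 1 / (2 * t) * (inverse F * (Y / T))" if "F \<noteq> 0" "T \<noteq> 0" for Y F T :: real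
        using assms that by (simp add: field_simps power2_eq_square)
      from this[of "fact m" "t ^ m" "y ^ m"] show ?thesis
        using assms by (simp add: power_divide)
    qed
    have "\<bar>c m\<bar> = (h\<^sup>2 / 4) ^ m / (fact m)\<^sup>2" "c m = (- (h\<^sup>2 / 4)) ^ m / (fact m)\<^sup>2"
      by (simp_all add: c_def abs_divide power_abs power_divide)
    then show "\<bar>c m\<bar> * (fact m / (2 * t ^ (m + 1))) = 1 / (2 * t) * (inverse (fact m) * (h\<^sup>2 / (4 * t)) ^ m)"
      "c m * (fact m / (2 * t ^ (m + 1))) = 1 / (2 * t) * (inverse (fact m) * (- (h\<^sup>2 / (4 * t))) ^ m)"
      by (simp_all only: *) simp_all
  qed
  have int: "has_bochner_integral halfline (f m) (c m * (fact m / (2 * t ^ (m + 1))))" for m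
    unfolding f_def by (intro has_bochner_integral_mult_right gaussian_odd_moment_halfline assms)
  have int_norm: "(\<integral>k. norm (f m k) \<partial>halfline) = \<bar>c m\<bar> * (fact m / (2 * t ^ (m + 1)))" for m
  proof -
    have "(\<integral>k. norm (f m k) \<partial>halfline) = (\<integral>k. \<bar>c m\<bar> * (k ^ (2 * m + 1) * exp (- t * k\<^sup>2)) \<partial>halfline)"
      by (intro Bochner_Integration.integral_cong) (auto simp: f_def abs_mult)
    then show ?thesis
      unfolding integral_mult_right_zero has_bochner_integral_integral_eq[OF gaussian_odd_moment_halfline[OF assms]] .
  qed
  have f_sums: "(\<lambda>m. f m k) sums (k * Bessel_J 0 (k * h) * exp (- t * k\<^sup>2))" for k
  proof -
    have "c m * k ^ (2 * m) = (- ((k * h / 2)\<^sup>2)) ^ m / (fact m)\<^sup>2" for m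
    proof -
      have "(- ((h / 2)\<^sup>2)) ^ m * k ^ (2 * m) = (- ((k * h / 2)\<^sup>2)) ^ m"
        unfolding power_mult power_mult_distrib [symmetric] by (simp add: power_mult_distrib power_divide mult.commute)
      then show ?thesis by (simp add: c_def)
    qed
    then have "(\<lambda>m. c m * k ^ (2 * m)) sums Bessel_J 0 (k * h)"
      using Bessel_J_0_sums[of "k * h"] by simp
    from sums_mult2[OF this, of "k * exp (- t * k\<^sup>2)"] show ?thesis
      by (simp add: f_def mult_ac)
  qed
  have "(\<lambda>m. \<integral>k. f m k \<partial>halfline) sums (\<integral>k. (\<Sum>m. f m k) \<partial>halfline)"
  proof (rule sums_integral)
    show "integrable halfline (f m)" for m
      using int by (rule integrable.intros)
    show "AE k in halfline. summable (\<lambda>m. norm (f m k))"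
    proof (rule AE_I2)
      fix k
      have "summable (\<lambda>m. \<bar>k * exp (- t * k\<^sup>2)\<bar> * (inverse (fact m) * ((h / 2)\<^sup>2 * k\<^sup>2) ^ m))"
        by (intro summable_mult summable_exp)
      then show "summable (\<lambda>m. norm (f m k))"
      proof (rule summable_comparison_test')
        fix m :: nat
        have "\<bar>c m\<bar> = ((h / 2)\<^sup>2) ^ m / (fact m)\<^sup>2"
        proof -
          have "\<bar>- ((h / 2)\<^sup>2)\<bar> = (h / 2)\<^sup>2" "\<bar>(fact m)\<^sup>2\<bar> = ((fact m)\<^sup>2 :: real)"
            by (simp_all only: abs_minus_cancel abs_power2)
          then show ?thesis
            unfolding c_def abs_divide power_abs by (simp only: power_abs [symmetric])
        qed
        also have "\<dots> \<le> ((h / 2)\<^sup>2) ^ m / fact m"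
          by (intro divide_left_mono) (auto simp: power2_eq_square)
        finally have "\<bar>c m\<bar> * (\<bar>k\<bar> ^ (2 * m + 1) * exp (- t * k\<^sup>2)) \<le>
            ((h / 2)\<^sup>2) ^ m / fact m * (\<bar>k\<bar> ^ (2 * m + 1) * exp (- t * k\<^sup>2))"
          by (intro mult_right_mono) auto
        also have "\<dots> = \<bar>k * exp (- t * k\<^sup>2)\<bar> * (inverse (fact m) * ((h / 2)\<^sup>2 * k\<^sup>2) ^ m)"
        proof -
          have "\<bar>k\<bar> ^ (2 * m + 1) = \<bar>k\<bar> * (k\<^sup>2) ^ m"
            by (simp add: power_mult)
          then show ?thesis
            by (simp only: divide_inverse abs_mult abs_exp_cancel power_mult_distrib mult_ac)
        qed
        finally show "norm (norm (f m k)) \<le> \<bar>k * exp (- t * k\<^sup>2)\<bar> * (inverse (fact m) * ((h / 2)\<^sup>2 * k\<^sup>2) ^ m)"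
          by (simp add: f_def abs_mult power_abs)
      qed
    qed
    show "summable (\<lambda>m. \<integral>k. norm (f m k) \<partial>halfline)"
      unfolding int_norm pos by (intro summable_mult summable_exp)
  qed
  then have "(\<lambda>m. c m * (fact m / (2 * t ^ (m + 1)))) sums (\<integral>k. k * Bessel_J 0 (k * h) * exp (- t * k\<^sup>2) \<partial>halfline)"
    unfolding has_bochner_integral_integral_eq[OF int] using f_sums by (simp only: sums_iff)
  moreover have "(\<lambda>m. c m * (fact m / (2 * t ^ (m + 1)))) sums (1 / (2 * t) * exp (- (h\<^sup>2 / (4 * t))))"
    unfolding alt using exp_converges[of "- (h\<^sup>2 / (4 * t))"]
    by (intro sums_mult) (simp add: scaleR_conv_of_real)
  ultimately have "(\<integral>k. k * Bessel_J 0 (k * h) * exp (- t * k\<^sup>2) \<partial>halfline) = 1 / (2 * t) * exp (- (h\<^sup>2 / (4 * t)))"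
    by (rule sums_unique2)
  then show ?thesis by simp
qed

lemma gaussian_first_moment:
  assumes "t > 0"
  shows "integrable halfline (\<lambda>k. k * exp (- t * k\<^sup>2))" "(\<integral>k. k * exp (- t * k\<^sup>2) \<partial>halfline) = 1 / (2 * t)"
  using gaussian_odd_moment_halfline[OF assms, of 0] by (simp_all add: has_bochner_integral_iff)

text \<open>
  Fubini's theorem.  Absolute integrability follows from \<open>\<bar>J\<^sub>0\<bar> \<le> 1\<close>, since integrating out \<open>k\<close> then leaves
  at most \<open>\<bar>w t\<bar> / (2 * t)\<close>.
\<close>

lemma hankel_transform_gaussian_mixture:
  assumes [measurable]: "w \<in> borel_measurable halfline" and w: "integrable halfline (\<lambda>t. \<bar>w t\<bar> / t)" and "h \<ge> 0"
  shows "(\<integral>k. k * Bessel_J 0 (k * h) * (\<integral>t. w t * exp (- t * k\<^sup>2) \<partial>halfline) \<partial>halfline) =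
    (\<integral>t. w t / (2 * t) * exp (- (h\<^sup>2 / (4 * t))) \<partial>halfline)"
proof -
  interpret sigma_finite_measure halfline by (rule sigma_finite_halfline)
  interpret pair_sigma_finite halfline halfline ..
  define f where "f = (\<lambda>(t, k). w t * (k * Bessel_J 0 (k * h) * exp (- t * k\<^sup>2)))"
  have f_meas [measurable]: "f \<in> borel_measurable (halfline \<Otimes>\<^sub>M halfline)"
    unfolding f_def by measurable
  have bound: "norm (f (t, k)) \<le> \<bar>w t\<bar> * (k * exp (- t * k\<^sup>2))" if "k > 0" for t k
  proof -
    have "\<bar>Bessel_J 0 (k * h)\<bar> * (\<bar>w t\<bar> * (k * exp (- t * k\<^sup>2))) \<le> 1 * (\<bar>w t\<bar> * (k * exp (- t * k\<^sup>2)))"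
      using that \<open>h \<ge> 0\<close> by (intro mult_right_mono abs_Bessel_J_0_le_1) auto
    then show ?thesis using that by (simp add: f_def abs_mult mult_ac)
  qed
  have int_k: "integrable halfline (\<lambda>k. f (t, k))" if "t > 0" for t
  proof (rule Bochner_Integration.integrable_bound)
    show "integrable halfline (\<lambda>k. \<bar>w t\<bar> * (k * exp (- t * k\<^sup>2)))"
      by (intro integrable_mult_right gaussian_first_moment that)
    show "AE k in halfline. norm (f (t, k)) \<le> norm (\<bar>w t\<bar> * (k * exp (- t * k\<^sup>2)))"
      using bound[of _ t] by (intro AE_I2) (auto simp: abs_mult)
    have "(\<lambda>k. w t * (k * Bessel_J 0 (k * h) * exp (- t * k\<^sup>2))) \<in> borel_measurable halfline"
      by measurable
    then show "(\<lambda>k. f (t, k)) \<in> borel_measurable halfline"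
      by (simp add: f_def)
  qed
  have "integrable (halfline \<Otimes>\<^sub>M halfline) f"
  proof (rule Fubini_integrable)
    show "AE t in halfline. integrable halfline (\<lambda>k. f (t, k))"
      using int_k by (intro AE_I2) simp
    show "integrable halfline (\<lambda>t. \<integral>k. norm (f (t, k)) \<partial>halfline)"
    proof (rule Bochner_Integration.integrable_bound)
      show "integrable halfline (\<lambda>t. 1 / 2 * (\<bar>w t\<bar> / t))"
        by (intro integrable_mult_right w)
      show "AE t in halfline. norm (\<integral>k. norm (f (t, k)) \<partial>halfline) \<le> norm (1 / 2 * (\<bar>w t\<bar> / t))"
      proof (rule AE_I2)
        fix t assume "t \<in> space halfline"
        then have t: "t > 0" by simp
        have "(\<integral>k. norm (f (t, k)) \<partial>halfline) \<le> (\<integral>k. \<bar>w t\<bar> * (k * exp (- t * k\<^sup>2)) \<partial>halfline)"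
          using bound[of _ t] t
          by (intro integral_mono integrable_norm int_k integrable_mult_right gaussian_first_moment) auto
        also have "\<dots> = 1 / 2 * (\<bar>w t\<bar> / t)"
          using gaussian_first_moment[OF t] by simp
        finally show "norm (\<integral>k. norm (f (t, k)) \<partial>halfline) \<le> norm (1 / 2 * (\<bar>w t\<bar> / t))"
          using t by (simp add: abs_mult)
      qed
    qed measurable
  qed fact
  then have "(\<integral>k. (\<integral>t. f (t, k) \<partial>halfline) \<partial>halfline) = (\<integral>t. (\<integral>k. f (t, k) \<partial>halfline) \<partial>halfline)"
    using Fubini_integral[of "\<lambda>t k. f (t, k)"] by simp
  moreover have "(\<integral>t. f (t, k) \<partial>halfline) = k * Bessel_J 0 (k * h) * (\<integral>t. w t * exp (- t * k\<^sup>2) \<partial>halfline)" for k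
    unfolding integral_mult_right_zero [symmetric]
    by (intro Bochner_Integration.integral_cong refl) (simp add: f_def mult_ac)
  moreover have "(\<integral>k. f (t, k) \<partial>halfline) = w t / (2 * t) * exp (- (h\<^sup>2 / (4 * t)))" if "t > 0" for t
    unfolding f_def case_prod_conv integral_mult_right_zero hankel_transform_gaussian[OF that] by simp
  then have "(\<integral>t. (\<integral>k. f (t, k) \<partial>halfline) \<partial>halfline) = (\<integral>t. w t / (2 * t) * exp (- (h\<^sup>2 / (4 * t))) \<partial>halfline)"
    by (intro Bochner_Integration.integral_cong) auto
  ultimately show ?thesis by simp
qed

lemma integral_halfline_scale:
  fixes f :: "real \<Rightarrow> 'a::{banach,second_countable_topology}"
  assumes "c > 0"
  shows "(\<integral>t. f (c * t) \<partial>halfline) = (\<integral>t. f t \<partial>halfline) /\<^sub>R c"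
    and "integrable halfline (\<lambda>t. f (c * t)) \<longleftrightarrow> integrable halfline f"
proof -
  have eq: "indicat_real {0<..} (c * t) = indicat_real {0<..} t" for t
    using assms by (simp add: indicator_def zero_less_mult_iff)
  show "(\<integral>t. f (c * t) \<partial>halfline) = (\<integral>t. f t \<partial>halfline) /\<^sub>R c"
    using lborel_integral_real_affine[of c "\<lambda>t. indicator {0<..} t *\<^sub>R f t" 0] assms
    by (simp add: integral_restrict_space eq del: real_scaleR_def)
  show "integrable halfline (\<lambda>t. f (c * t)) \<longleftrightarrow> integrable halfline f"
    using lborel_integrable_real_affine_iff[of c "\<lambda>t. indicator {0<..} t *\<^sub>R f t" 0] assms
    by (simp add: integrable_restrict_space eq del: real_scaleR_def)
qed

lemma exponential_integral_halfline:
  assumes "c > 0"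
  shows "integrable halfline (\<lambda>t. exp (- c * t))" "(\<integral>t. exp (- c * t) \<partial>halfline) = 1 / c"
    and "integrable halfline (\<lambda>t. t * exp (- c * t))" "(\<integral>t. t * exp (- c * t) \<partial>halfline) = 1 / c\<^sup>2"
proof -
  have Gamma: "has_bochner_integral halfline (\<lambda>t. t powr (\<nu> - 1) * exp (- t)) (Gamma \<nu>)" if "\<nu> > 0" for \<nu>
    using Gamma_integral_halfline[OF that] by (simp add: has_bochner_integral_iff)
  have 1: "has_bochner_integral halfline (\<lambda>t. exp (- t)) 1"
    by (rule has_bochner_integral_cong[THEN iffD1, OF refl _ _ Gamma[of 1]]) auto
  have 2: "has_bochner_integral halfline (\<lambda>t. t * exp (- t)) 1"
    by (rule has_bochner_integral_cong[THEN iffD1, OF refl _ _ Gamma[of 2]]) (auto simp: Gamma_numeral)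
  show "integrable halfline (\<lambda>t. exp (- c * t))" "(\<integral>t. exp (- c * t) \<partial>halfline) = 1 / c"
    using integral_halfline_scale[OF assms, of "\<lambda>t. exp (- t)"] 1 by (simp_all add: has_bochner_integral_iff inverse_eq_divide)
  have "integrable halfline (\<lambda>t. c * (t * exp (- c * t)))" "(\<integral>t. c * (t * exp (- c * t)) \<partial>halfline) = 1 / c"
    using integral_halfline_scale[OF assms, of "\<lambda>t. t * exp (- t)"] 2 by (simp_all add: has_bochner_integral_iff inverse_eq_divide mult.assoc)
  then have "integrable halfline (\<lambda>t. t * exp (- c * t))" "c * (\<integral>t. t * exp (- c * t) \<partial>halfline) = 1 / c"
    unfolding integral_mult_right_zero integrable_mult_left_iff using assms by auto
  then show "integrable halfline (\<lambda>t. t * exp (- c * t))" "(\<integral>t. t * exp (- c * t) \<partial>halfline) = 1 / c\<^sup>2"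
    using assms by (auto simp add: field_simps power2_eq_square)
qed

text \<open>
  The weight \<open>t * exp (- t)\<close> produces the mixture \<open>1 / (1 + k\<^sup>2)\<^sup>2\<close>.
\<close>

lemma hankel_transform_double_pole:
  assumes "h > 0"
  shows "complex_of_real (\<integral>k. k * Bessel_J 0 (k * h) / (1 + k\<^sup>2)\<^sup>2 \<partial>halfline) = of_real (h / 2) * Bessel_K (-1) (of_real h)"
proof -
  have "(\<integral>k. k * Bessel_J 0 (k * h) / (1 + k\<^sup>2)\<^sup>2 \<partial>halfline) =
      (\<integral>k. k * Bessel_J 0 (k * h) * (\<integral>t. t * exp (- t) * exp (- t * k\<^sup>2) \<partial>halfline) \<partial>halfline)"
  proof -
    have "(\<integral>t. t * exp (- t) * exp (- t * k\<^sup>2) \<partial>halfline) = 1 / (1 + k\<^sup>2)\<^sup>2" for k :: real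
      using exponential_integral_halfline(4)[of "1 + k\<^sup>2"]
      by (simp add: mult.assoc exp_add [symmetric] add_pos_nonneg algebra_simps)
    then show ?thesis by simp
  qed
  also have "\<dots> = (\<integral>t. t * exp (- t) / (2 * t) * exp (- (h\<^sup>2 / (4 * t))) \<partial>halfline)"
  proof (rule hankel_transform_gaussian_mixture)
    show "integrable halfline (\<lambda>t. \<bar>t * exp (- t)\<bar> / t)"
      using exponential_integral_halfline(1)[of 1]
      by (rule Bochner_Integration.integrable_cong[THEN iffD1, OF refl, rotated]) (auto simp: abs_mult)
  qed (use assms in auto)
  also have "\<dots> = (\<integral>t. 1 / 2 * (t powr (1 - 1) * exp (- t - (h\<^sup>2 / 4) / t)) \<partial>halfline)"
  proof (intro Bochner_Integration.integral_cong refl)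
    fix t assume "t \<in> space halfline"
    then have "t > 0" by simp
    then show "t * exp (- t) / (2 * t) * exp (- (h\<^sup>2 / (4 * t))) = 1 / 2 * (t powr (1 - 1) * exp (- t - (h\<^sup>2 / 4) / t))"
      by (simp add: mult_exp_exp)
  qed
  also have "\<dots> = 1 / 2 * heat_integral 1 (h\<^sup>2 / 4)"
    by (simp add: heat_integral_def)
  finally have eq: "(\<integral>k. k * Bessel_J 0 (k * h) / (1 + k\<^sup>2)\<^sup>2 \<partial>halfline) = 1 / 2 * heat_integral 1 (h\<^sup>2 / 4)" .
  show ?thesis
    unfolding eq using assms by (simp add: Bessel_K_minus_1_real)
qed

text \<open>
  The weight \<open>exp (- a * t) - exp (- t)\<close> produces \<open>1 / (k\<^sup>2 + a) - 1 / (k\<^sup>2 + 1)\<close>.  Subtracting the pole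
  at \<open>1\<close> makes the weight \<open>O(t)\<close> at \<open>0\<close>, as Fubini's theorem requires.
\<close>

lemma hankel_transform_simple_pole_real:
  assumes "h > 0" "a > 0"
  shows "Bessel_K 0 (of_real (h * sqrt a)) = Bessel_K 0 (of_real h) +
    of_real ((1 - a) * (\<integral>k. k * Bessel_J 0 (k * h) / ((k\<^sup>2 + a) * (k\<^sup>2 + 1)) \<partial>halfline))"
proof -
  define w where "w = (\<lambda>t. exp (- a * t) - exp (- t))"
  have [measurable]: "w \<in> borel_measurable halfline"
    unfolding w_def by measurable
  have w_int: "integrable halfline (\<lambda>t. \<bar>w t\<bar> / t)"
  proof (rule Bochner_Integration.integrable_bound)
    show "integrable halfline (\<lambda>t. \<bar>1 - a\<bar> * exp (- min a 1 * t))"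
      using assms by (intro integrable_mult_right exponential_integral_halfline(1)) auto
    show "AE t in halfline. norm (\<bar>w t\<bar> / t) \<le> norm (\<bar>1 - a\<bar> * exp (- min a 1 * t))"
    proof (rule AE_I2)
      fix t assume "t \<in> space halfline"
      then have t: "t > 0" by simp
      have "norm (exp (- a * t) - exp (- 1 * t)) \<le> t * exp (- min a 1 * t) * norm (a - 1)"
      proof (rule field_differentiable_bound[of "{min a 1..max a 1}" "\<lambda>b. exp (- b * t)" "\<lambda>b. - t * exp (- b * t)"])
        show "((\<lambda>b. exp (- b * t)) has_real_derivative - t * exp (- b * t)) (at b within {min a 1..max a 1})" for b
          by (auto intro!: derivative_eq_intros)
        show "norm (- t * exp (- b * t)) \<le> t * exp (- min a 1 * t)" if "b \<in> {min a 1..max a 1}" for b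
        proof -
          have "min a 1 * t \<le> b * t"
            using t that by (intro mult_right_mono) auto
          then show ?thesis using t by (simp add: abs_mult)
        qed
      qed auto
      then show "norm (\<bar>w t\<bar> / t) \<le> norm (\<bar>1 - a\<bar> * exp (- min a 1 * t))"
        using t by (simp add: w_def field_simps abs_minus_commute abs_mult)
    qed
  qed measurable
  have "(\<integral>t. w t * exp (- t * k\<^sup>2) \<partial>halfline) = (1 - a) * (1 / ((k\<^sup>2 + a) * (k\<^sup>2 + 1)))" for k
  proof -
    have pos: "k\<^sup>2 + a > 0" "k\<^sup>2 + 1 > 0"
      using assms by (auto intro: add_nonneg_pos)
    have "(\<integral>t. w t * exp (- t * k\<^sup>2) \<partial>halfline) = (\<integral>t. exp (- (k\<^sup>2 + a) * t) - exp (- (k\<^sup>2 + 1) * t) \<partial>halfline)"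
      by (intro Bochner_Integration.integral_cong) (auto simp: w_def left_diff_distrib exp_add [symmetric] algebra_simps)
    also have "\<dots> = 1 / (k\<^sup>2 + a) - 1 / (k\<^sup>2 + 1)"
      using pos by (simp only: Bochner_Integration.integral_diff exponential_integral_halfline)
    also have "\<dots> = (1 - a) * (1 / ((k\<^sup>2 + a) * (k\<^sup>2 + 1)))"
      using pos by (simp add: divide_simps)
    finally show ?thesis .
  qed
  then have "(\<integral>k. k * Bessel_J 0 (k * h) * (\<integral>t. w t * exp (- t * k\<^sup>2) \<partial>halfline) \<partial>halfline) =
      (\<integral>k. (1 - a) * (k * Bessel_J 0 (k * h) / ((k\<^sup>2 + a) * (k\<^sup>2 + 1))) \<partial>halfline)"
    by (simp add: mult_ac)
  then have "(1 - a) * (\<integral>k. k * Bessel_J 0 (k * h) / ((k\<^sup>2 + a) * (k\<^sup>2 + 1)) \<partial>halfline) =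
      (\<integral>k. k * Bessel_J 0 (k * h) * (\<integral>t. w t * exp (- t * k\<^sup>2) \<partial>halfline) \<partial>halfline)"
    by (simp only: integral_mult_right_zero)
  also have "\<dots> = (\<integral>t. w t / (2 * t) * exp (- (h\<^sup>2 / (4 * t))) \<partial>halfline)"
    using assms w_int by (intro hankel_transform_gaussian_mixture) auto
  also have "\<dots> = (\<integral>t. a / 2 * ((a * t) powr (0 - 1) * exp (- (a * t) - (a * (h\<^sup>2 / 4)) / (a * t)))
      - 1 / 2 * (t powr (0 - 1) * exp (- t - (h\<^sup>2 / 4) / t)) \<partial>halfline)"
  proof (intro Bochner_Integration.integral_cong refl)
    fix t assume "t \<in> space halfline"
    then have t: "t > 0" by simp
    \<comment> \<open>The first term is written as a function of \<open>a * t\<close>: after rescaling, both are heat kernels of order \<open>0\<close>.\<close>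
    define E where "E = exp (- (h\<^sup>2 / (4 * t)))"
    have "(a * t) powr (0 - 1) = 1 / (a * t)" "t powr (0 - 1) = 1 / t"
      using t assms by (simp_all add: powr_minus_divide)
    moreover have "exp (- (a * t) - (a * (h\<^sup>2 / 4)) / (a * t)) = exp (- a * t) * E"
      "exp (- t - (h\<^sup>2 / 4) / t) = exp (- t) * E"
      using assms by (simp_all add: E_def mult_exp_exp)
    moreover have "w t / (2 * t) * E = a / 2 * (1 / (a * t) * (exp (- a * t) * E)) - 1 / 2 * (1 / t * (exp (- t) * E))"
      using t assms by (simp add: w_def field_simps)
    ultimately show "w t / (2 * t) * exp (- (h\<^sup>2 / (4 * t))) =
        a / 2 * ((a * t) powr (0 - 1) * exp (- (a * t) - (a * (h\<^sup>2 / 4)) / (a * t)))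
        - 1 / 2 * (t powr (0 - 1) * exp (- t - (h\<^sup>2 / 4) / t))"
      by (simp only: E_def)
  qed
  also have "\<dots> = (\<integral>t. a / 2 * ((a * t) powr (0 - 1) * exp (- (a * t) - (a * (h\<^sup>2 / 4)) / (a * t))) \<partial>halfline)
      - (\<integral>t. 1 / 2 * (t powr (0 - 1) * exp (- t - (h\<^sup>2 / 4) / t)) \<partial>halfline)"
    using assms integral_halfline_scale(2)[of a "\<lambda>t. t powr (0 - 1) * exp (- t - (a * (h\<^sup>2 / 4)) / t)"]
      integrable_heat_kernel[of 0 "a * (h\<^sup>2 / 4)"] integrable_heat_kernel[of 0 "h\<^sup>2 / 4"]
    by (intro Bochner_Integration.integral_diff integrable_mult_right) auto
  also have "\<dots> = heat_integral 0 (a * (h\<^sup>2 / 4)) / 2 - heat_integral 0 (h\<^sup>2 / 4) / 2"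
    using assms integral_halfline_scale(1)[of a "\<lambda>t. t powr (0 - 1) * exp (- t - (a * (h\<^sup>2 / 4)) / t)"]
    by (simp only: integral_mult_right_zero heat_integral_def) simp
  finally have "(1 - a) * (\<integral>k. k * Bessel_J 0 (k * h) / ((k\<^sup>2 + a) * (k\<^sup>2 + 1)) \<partial>halfline) =
      heat_integral 0 (a * (h\<^sup>2 / 4)) / 2 - heat_integral 0 (h\<^sup>2 / 4) / 2" .
  moreover have "(h * sqrt a)\<^sup>2 / 4 = a * (h\<^sup>2 / 4)"
    using assms by (simp add: power_mult_distrib)
  ultimately show ?thesis
    using assms Bessel_K_0_real[of h] Bessel_K_0_real[of "h * sqrt a"] by (simp only: of_real_add [symmetric]) simp
qed

section \<open>Analytic continuation to complex poles\<close>

lemma nonpos_Reals_eq_image: "\<real>\<^sub>\<le>\<^sub>0 = complex_of_real ` {..0}"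
  by (auto simp: nonpos_Reals_def)

text \<open>
  Division by \<open>1 + k\<^sup>2\<close> turns \<open>k\<^sup>2 + a\<close> into a point of the segment from \<open>1\<close> to \<open>a\<close>, and this compact
  segment avoids \<open>0\<close>.
\<close>

lemma slit_plane_pole_bound:
  assumes "a \<notin> \<real>\<^sub>\<le>\<^sub>0"
  obtains c where "c > 0" "\<And>k::real. c * (1 + k\<^sup>2) \<le> cmod ((of_real k)\<^sup>2 + a)"
proof -
  have "0 \<notin> closed_segment 1 a"
    using starlike_slotted_complex_plane_left_aux[of a 0 1] assms by (auto simp: nonpos_Reals_eq_image)
  then obtain c where c: "c > 0" "\<And>w. w \<in> closed_segment 1 a \<Longrightarrow> c \<le> cmod w"
    using separate_point_closed[of "closed_segment 1 a" 0] by auto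
  show thesis
  proof (rule that[OF c(1)])
    fix k :: real
    have pos: "1 + k\<^sup>2 > 0"
      by (intro add_pos_nonneg) auto
    have "((of_real k)\<^sup>2 + a) / of_real (1 + k\<^sup>2) \<in> closed_segment 1 a"
      unfolding in_segment
    proof (intro exI conjI)
      show "((of_real k)\<^sup>2 + a) / of_real (1 + k\<^sup>2) = (1 - 1 / (1 + k\<^sup>2)) *\<^sub>R 1 + (1 / (1 + k\<^sup>2)) *\<^sub>R a"
      proof -
        have "1 - 1 / (1 + k\<^sup>2) = k\<^sup>2 / (1 + k\<^sup>2)"
          using pos by (simp add: diff_divide_eq_iff)
        then show ?thesis
          by (simp only: scaleR_conv_of_real) (simp add: add_divide_distrib)
      qed
    qed (use pos in auto)
    from c(2)[OF this] have "c \<le> cmod ((of_real k)\<^sup>2 + a) / (1 + k\<^sup>2)"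
      unfolding norm_divide norm_of_real using pos by simp
    then show "c * (1 + k\<^sup>2) \<le> cmod ((of_real k)\<^sup>2 + a)"
      using pos by (simp only: pos_le_divide_eq)
  qed
qed

lemma integrable_double_pole_majorant: "integrable halfline (\<lambda>k. k / (1 + k\<^sup>2)\<^sup>2)"
proof (rule Bochner_Integration.integrable_bound)
  show "integrable halfline (\<lambda>k. inverse (1 + k\<^sup>2))"
  proof -
    have "integrable lborel (\<lambda>k::real. inverse (1 + k\<^sup>2))"
      using integrable_inverse_1_plus_square by (simp add: set_integrable_def)
    from integrable_mult_indicator[OF _ this, of "{0<..}"] show ?thesis
      by (simp add: integrable_restrict_space)
  qed
  show "AE k in halfline. norm (k / (1 + k\<^sup>2)\<^sup>2) \<le> norm (inverse (1 + k\<^sup>2))"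
  proof (rule AE_I2)
    fix k :: real assume "k \<in> space halfline"
    then have k: "k > 0" by simp
    have "(k - 1)\<^sup>2 \<ge> 0" by simp
    then have "k \<le> 1 + k\<^sup>2"
      using k by (simp add: power2_eq_square algebra_simps)
    moreover have pos: "1 + k\<^sup>2 > 0"
      by (intro add_pos_nonneg) auto
    ultimately have "k / (1 + k\<^sup>2)\<^sup>2 \<le> (1 + k\<^sup>2) / (1 + k\<^sup>2)\<^sup>2"
      by (intro divide_right_mono) auto
    also have "\<dots> = inverse (1 + k\<^sup>2)"
      using pos by (simp add: power2_eq_square inverse_eq_divide)
    finally show "norm (k / (1 + k\<^sup>2)\<^sup>2) \<le> norm (inverse (1 + k\<^sup>2))"
      using k pos by simp
  qed
qed auto

lemma norm_hankel_integrand_le: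
  fixes d :: "'a::real_normed_field"
  assumes "k > 0" "h \<ge> 0" "c > 0" "c * (1 + k\<^sup>2)\<^sup>2 \<le> norm d"
  shows "norm (of_real (k * Bessel_J 0 (k * h)) / d) \<le> 1 / c * (k / (1 + k\<^sup>2)\<^sup>2)"
proof -
  have pos: "c * (1 + k\<^sup>2)\<^sup>2 > 0"
    using assms by (intro mult_pos_pos zero_less_power add_pos_nonneg) auto
  have "\<bar>k * Bessel_J 0 (k * h)\<bar> \<le> k"
    using mult_left_mono[OF abs_Bessel_J_0_le_1[of "k * h"], of k] assms by (simp add: abs_mult)
  then have "norm (of_real (k * Bessel_J 0 (k * h)) / d) \<le> k / norm d"
    unfolding norm_divide norm_of_real by (intro divide_right_mono) auto
  also have "\<dots> \<le> k / (c * (1 + k\<^sup>2)\<^sup>2)"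
    using assms pos by (intro divide_left_mono mult_pos_pos) auto
  finally show ?thesis by simp
qed

lemma integrable_hankel_integrand:
  fixes d :: "real \<Rightarrow> 'a::{real_normed_field,banach,second_countable_topology}"
  assumes [measurable]: "d \<in> borel_measurable borel"
    and "h \<ge> 0" "c > 0" "\<And>k. k > 0 \<Longrightarrow> c * (1 + k\<^sup>2)\<^sup>2 \<le> norm (d k)"
  shows "integrable halfline (\<lambda>k. of_real (k * Bessel_J 0 (k * h)) / d k)"
proof (rule Bochner_Integration.integrable_bound)
  show "integrable halfline (\<lambda>k. 1 / c * (k / (1 + k\<^sup>2)\<^sup>2))"
    by (intro integrable_mult_right integrable_double_pole_majorant)
  show "AE k in halfline. norm (of_real (k * Bessel_J 0 (k * h)) / d k) \<le> norm (1 / c * (k / (1 + k\<^sup>2)\<^sup>2))"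
  proof (rule AE_I2)
    fix k assume "k \<in> space halfline"
    then have k: "k > 0" by simp
    have "norm (of_real (k * Bessel_J 0 (k * h)) / d k) \<le> 1 / c * (k / (1 + k\<^sup>2)\<^sup>2)"
      using assms k by (intro norm_hankel_integrand_le) auto
    then show "norm (of_real (k * Bessel_J 0 (k * h)) / d k) \<le> norm (1 / c * (k / (1 + k\<^sup>2)\<^sup>2))"
      by (metis abs_ge_self order_trans real_norm_def)
  qed
  show "(\<lambda>k. of_real (k * Bessel_J 0 (k * h)) / d k) \<in> borel_measurable halfline"
    by (intro measurable_halflineI) measurable
qed

lemma two_pole_bound:
  assumes "a \<notin> \<real>\<^sub>\<le>\<^sub>0" "b \<notin> \<real>\<^sub>\<le>\<^sub>0"
  obtains c where "c > 0" "\<And>k::real. c * (1 + k\<^sup>2)\<^sup>2 \<le> cmod (((of_real k)\<^sup>2 + a) * ((of_real k)\<^sup>2 + b))"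
proof -
  obtain ca where ca: "ca > 0" "\<And>k::real. ca * (1 + k\<^sup>2) \<le> cmod ((of_real k)\<^sup>2 + a)"
    using slit_plane_pole_bound[OF assms(1)] by blast
  obtain cb where cb: "cb > 0" "\<And>k::real. cb * (1 + k\<^sup>2) \<le> cmod ((of_real k)\<^sup>2 + b)"
    using slit_plane_pole_bound[OF assms(2)] by blast
  show thesis
  proof (rule that[of "ca * cb"])
    fix k :: real
    have "(ca * (1 + k\<^sup>2)) * (cb * (1 + k\<^sup>2)) \<le> cmod ((of_real k)\<^sup>2 + a) * cmod ((of_real k)\<^sup>2 + b)"
      using ca cb by (intro mult_mono) auto
    then show "ca * cb * (1 + k\<^sup>2)\<^sup>2 \<le> cmod (((of_real k)\<^sup>2 + a) * ((of_real k)\<^sup>2 + b))"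
      by (simp only: norm_mult power2_eq_square mult_ac)
  qed (use ca cb in auto)
qed

definition hankel_two_poles :: "real \<Rightarrow> complex \<Rightarrow> complex \<Rightarrow> complex" where
  "hankel_two_poles h a b =
     (\<integral>k. of_real (k * Bessel_J 0 (k * h)) / (((of_real k)\<^sup>2 + a) * ((of_real k)\<^sup>2 + b)) \<partial>halfline)"

lemma integrable_hankel_two_poles:
  fixes a b :: complex
  assumes "a \<notin> \<real>\<^sub>\<le>\<^sub>0" "b \<notin> \<real>\<^sub>\<le>\<^sub>0" "h \<ge> 0"
  shows "integrable halfline (\<lambda>k. of_real (k * Bessel_J 0 (k * h)) / (((of_real k)\<^sup>2 + a) * ((of_real k)\<^sup>2 + b)))"
proof -
  obtain c where "c > 0" "\<And>k::real. c * (1 + k\<^sup>2)\<^sup>2 \<le> cmod (((of_real k)\<^sup>2 + a) * ((of_real k)\<^sup>2 + b))"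
    using two_pole_bound[OF assms(1,2)] by blast
  with assms(3) show ?thesis
    by (intro integrable_hankel_integrand[where c = c]) auto
qed

lemma one_notin_nonpos_Reals: "1 \<notin> \<real>\<^sub>\<le>\<^sub>0"
  by (simp add: complex_nonpos_Reals_iff)

text \<open>
  If \<open>\<bar>k\<^sup>2 + a\<bar> \<ge> c * (1 + k\<^sup>2)\<close>, then the same bound with \<open>c / 2\<close> holds for all \<open>y\<close> at distance less than
  \<open>c / 2\<close> from \<open>a\<close>; this dominates the derivative of the integrand near \<open>a\<close>.
\<close>

lemma hankel_two_poles_holomorphic:
  assumes "h \<ge> 0"
  shows "(\<lambda>a. hankel_two_poles h a 1) holomorphic_on - \<real>\<^sub>\<le>\<^sub>0"
proof -
  have "\<exists>D. ((\<lambda>a. hankel_two_poles h a 1) has_field_derivative D) (at a)" if a: "a \<notin> \<real>\<^sub>\<le>\<^sub>0" for a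
  proof -
    obtain c where c: "c > 0" "\<And>k::real. c * (1 + k\<^sup>2) \<le> cmod ((of_real k)\<^sup>2 + a)"
      using slit_plane_pole_bound[OF a] by blast
    define j where "j = (\<lambda>k. complex_of_real (k * Bessel_J 0 (k * h)))"
    define f where "f = (\<lambda>y k. j k / (((of_real k)\<^sup>2 + y) * ((of_real k)\<^sup>2 + 1)))"
    define f' where "f' = (\<lambda>y k. - (j k / (((of_real k)\<^sup>2 + y)\<^sup>2 * ((of_real k)\<^sup>2 + 1))))"
    have one: "cmod ((of_real k)\<^sup>2 + 1) = 1 + k\<^sup>2" for k :: real
    proof -
      have "(of_real k)\<^sup>2 + 1 = complex_of_real (1 + k\<^sup>2)" by simp
      then show ?thesis by (simp only: norm_of_real) simp
    qed
    have near: "c / 2 * (1 + k\<^sup>2) \<le> cmod ((of_real k)\<^sup>2 + y)" if "y \<in> ball a (c / 2)" for y and k :: real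
    proof -
      have "cmod ((of_real k)\<^sup>2 + a) \<le> cmod ((of_real k)\<^sup>2 + y) + cmod (a - y)"
        using norm_triangle_ineq[of "(of_real k)\<^sup>2 + y" "a - y"] by (simp add: algebra_simps)
      moreover have "cmod (a - y) \<le> c / 2 * (1 + k\<^sup>2)"
      proof -
        have "cmod (a - y) \<le> c / 2 * 1"
          using that by (simp add: dist_norm)
        also have "\<dots> \<le> c / 2 * (1 + k\<^sup>2)"
          using c(1) by (intro mult_left_mono) auto
        finally show ?thesis .
      qed
      ultimately show ?thesis
        using c(2)[of k] by (simp add: algebra_simps)
    qed
    have near1: "c / 2 * (1 + k\<^sup>2)\<^sup>2 \<le> cmod (((of_real k)\<^sup>2 + y) * ((of_real k)\<^sup>2 + 1))"
      if "y \<in> ball a (c / 2)" for y and k :: real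
    proof -
      have "c / 2 * (1 + k\<^sup>2) * (1 + k\<^sup>2) \<le> cmod ((of_real k)\<^sup>2 + y) * (1 + k\<^sup>2)"
        by (intro mult_right_mono near that) auto
      then show ?thesis
        by (simp only: norm_mult one power2_eq_square[of "1 + k\<^sup>2"] mult.assoc)
    qed
    have near2: "(c / 2)\<^sup>2 * (1 + k\<^sup>2)\<^sup>2 \<le> cmod (((of_real k)\<^sup>2 + y)\<^sup>2 * ((of_real k)\<^sup>2 + 1))"
      if "y \<in> ball a (c / 2)" for y and k :: real
    proof -
      have "(c / 2 * (1 + k\<^sup>2))\<^sup>2 * 1 \<le> (cmod ((of_real k)\<^sup>2 + y))\<^sup>2 * (1 + k\<^sup>2)"
        using c(1) by (intro mult_mono power_mono near that) auto
      then show ?thesis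
        by (simp only: norm_mult norm_power one power_mult_distrib mult_1_right)
    qed
    have "((\<lambda>y. integral\<^sup>L halfline (f y)) has_field_derivative integral\<^sup>L halfline (f' a)) (at a)"
    proof (rule has_field_derivative_integral[where \<delta> = "c / 2" and w = "\<lambda>k. 1 / (c / 2)\<^sup>2 * (k / (1 + k\<^sup>2)\<^sup>2)"])
      show "f y \<in> borel_measurable halfline" "f' a \<in> borel_measurable halfline" for y
        unfolding f_def f'_def j_def by (intro measurable_halflineI; measurable)+
      show "integrable halfline (\<lambda>k. 1 / (c / 2)\<^sup>2 * (k / (1 + k\<^sup>2)\<^sup>2))"
        by (intro integrable_mult_right integrable_double_pole_majorant)
      fix y assume y: "y \<in> ball a (c / 2)"
      show "integrable halfline (f y)"
        unfolding f_def j_def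
      proof (rule integrable_hankel_integrand[where c = "c / 2"])
        fix k :: real
        show "c / 2 * (1 + k\<^sup>2)\<^sup>2 \<le> norm (((of_real k)\<^sup>2 + y) * ((of_real k)\<^sup>2 + 1))"
          by (rule near1[OF y])
      qed (use assms c(1) in auto)
      fix k :: real assume "k \<in> space halfline"
      then have k: "k > 0" by simp
      have "0 < c / 2 * (1 + k\<^sup>2)"
        using c(1) by (intro mult_pos_pos add_pos_nonneg) auto
      then have nz: "(of_real k)\<^sup>2 + y \<noteq> 0" "(of_real k)\<^sup>2 + 1 \<noteq> (0 :: complex)"
        using near[OF y, of k] one[of k] by auto
      define q where "q = (of_real k)\<^sup>2 + (1 :: complex)"
      have "q \<noteq> 0"
        using nz(2) by (simp add: q_def)
      show "((\<lambda>y. f y k) has_field_derivative f' y k) (at y)"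
        unfolding f_def f'_def q_def [symmetric] using nz(1) \<open>q \<noteq> 0\<close>
        by (auto intro!: derivative_eq_intros simp: power2_eq_square divide_simps)
      have "norm (j k / (((of_real k)\<^sup>2 + y)\<^sup>2 * ((of_real k)\<^sup>2 + 1))) \<le> 1 / (c / 2)\<^sup>2 * (k / (1 + k\<^sup>2)\<^sup>2)"
        unfolding j_def using assms c(1) k by (intro norm_hankel_integrand_le near2[OF y]) auto
      then show "norm (f' y k) \<le> 1 / (c / 2)\<^sup>2 * (k / (1 + k\<^sup>2)\<^sup>2)"
        by (simp add: f'_def)
    qed (use c in auto)
    then show ?thesis
      by (auto simp: hankel_two_poles_def f_def j_def)
  qed
  then show ?thesis
    by (auto simp: holomorphic_on_open field_differentiable_def open_Compl)
qed

lemma mult_csqrt_in_slit_plane: "a \<notin> \<real>\<^sub>\<le>\<^sub>0 \<Longrightarrow> h > 0 \<Longrightarrow> of_real h * csqrt a \<notin> \<real>\<^sub>\<le>\<^sub>0"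
proof
  assume a: "a \<notin> \<real>\<^sub>\<le>\<^sub>0" and h: "h > 0" and "of_real h * csqrt a \<in> \<real>\<^sub>\<le>\<^sub>0"
  then have "h * Re (csqrt a) \<le> 0"
    unfolding complex_nonpos_Reals_iff by (simp only: times_complex.simps Re_complex_of_real Im_complex_of_real) simp
  with mult_pos_pos[OF h Re_csqrt_pos[OF a]] show False
    by linarith
qed

text \<open>
  Both sides are holomorphic functions of \<open>a\<close> in the slit plane, which is connected, and they agree on
  the positive real axis.
\<close>

lemma Bessel_K_0_slit_plane:
  assumes "h > 0" "a \<notin> \<real>\<^sub>\<le>\<^sub>0"
  shows "Bessel_K 0 (of_real h * csqrt a) = Bessel_K 0 (of_real h) + (1 - a) * hankel_two_poles h a 1"
proof -
  define F where "F = (\<lambda>a. Bessel_K 0 (of_real h * csqrt a) - (Bessel_K 0 (of_real h) + (1 - a) * hankel_two_poles h a 1))"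
  have "(Bessel_K 0 \<circ> (\<lambda>a. of_real h * csqrt a)) holomorphic_on - \<real>\<^sub>\<le>\<^sub>0"
  proof (rule holomorphic_on_compose_gen)
    show "Bessel_K 0 holomorphic_on - \<real>\<^sub>\<le>\<^sub>0"
      by (rule holomorphic_Bessel_K_0) auto
    show "(\<lambda>a. of_real h * csqrt a) ` (- \<real>\<^sub>\<le>\<^sub>0) \<subseteq> - \<real>\<^sub>\<le>\<^sub>0"
      using mult_csqrt_in_slit_plane assms(1) by auto
  qed (intro holomorphic_intros; simp)
  then have holo: "F holomorphic_on - \<real>\<^sub>\<le>\<^sub>0"
    unfolding F_def o_def using hankel_two_poles_holomorphic[of h] assms(1)
    by (intro holomorphic_intros) auto
  have on_reals: "F (of_real t) = 0" if "t > 0" for t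
  proof -
    have "hankel_two_poles h (of_real t) 1 =
        (\<integral>k. of_real (k * Bessel_J 0 (k * h) / ((k\<^sup>2 + t) * (k\<^sup>2 + 1))) \<partial>halfline)"
      unfolding hankel_two_poles_def by (intro Bochner_Integration.integral_cong) auto
    also have "\<dots> = of_real (\<integral>k. k * Bessel_J 0 (k * h) / ((k\<^sup>2 + t) * (k\<^sup>2 + 1)) \<partial>halfline)"
      by (rule integral_complex_of_real)
    finally have eq: "hankel_two_poles h (of_real t) 1 =
        of_real (\<integral>k. k * Bessel_J 0 (k * h) / ((k\<^sup>2 + t) * (k\<^sup>2 + 1)) \<partial>halfline)" .
    have "csqrt (of_real t) = of_real (sqrt t)"
      using that by simp
    then show ?thesis
      unfolding F_def eq using hankel_transform_simple_pole_real[OF assms(1) that] by simp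
  qed
  have "F a = 0"
  proof (rule analytic_continuation[OF holo, where U = "complex_of_real ` {0<..}" and \<xi> = 1])
    show "open (- \<real>\<^sub>\<le>\<^sub>0 :: complex set)"
      by (simp add: open_Compl)
    show "connected (- \<real>\<^sub>\<le>\<^sub>0 :: complex set)"
      unfolding nonpos_Reals_eq_image
      by (intro starlike_imp_connected starlike_slotted_complex_plane_left)
    show "complex_of_real ` {0<..} \<subseteq> - \<real>\<^sub>\<le>\<^sub>0"
      by (auto simp: complex_nonpos_Reals_iff)
    show "1 islimpt complex_of_real ` {0<..}"
      unfolding islimpt_approachable
    proof (intro allI impI)
      fix e :: real assume "e > 0"
      moreover have "complex_of_real (1 + e / 2) - 1 = of_real (e / 2)"
        by simp
      then have "dist (complex_of_real (1 + e / 2)) 1 = \<bar>e / 2\<bar>"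
        unfolding dist_norm by (simp only: norm_of_real)
      ultimately show "\<exists>x'\<in>complex_of_real ` {0<..}. x' \<noteq> 1 \<and> dist x' 1 < e"
        by (intro bexI[of _ "of_real (1 + e / 2)"] conjI imageI) (auto simp del: of_real_add)
    qed
  qed (use on_reals assms one_notin_nonpos_Reals in auto)
  then show ?thesis by (simp add: F_def)
qed

text \<open>
  Partial fractions: the auxiliary pole at \<open>1\<close> cancels from the difference of two instances of
  \<open>Bessel_K_0_slit_plane\<close>.
\<close>

lemma Bessel_K_0_diff:
  assumes "h > 0" "a \<notin> \<real>\<^sub>\<le>\<^sub>0" "b \<notin> \<real>\<^sub>\<le>\<^sub>0"
  shows "Bessel_K 0 (of_real h * csqrt a) - Bessel_K 0 (of_real h * csqrt b) = (b - a) * hankel_two_poles h a b"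
proof -
  define j where "j = (\<lambda>k. complex_of_real (k * Bessel_J 0 (k * h)))"
  let ?I = "\<lambda>a b k. j k / (((of_real k)\<^sup>2 + a) * ((of_real k)\<^sup>2 + b))"
  have int: "integrable halfline (?I a 1)" "integrable halfline (?I b 1)" "integrable halfline (?I a b)"
    unfolding j_def
    by (rule integrable_hankel_two_poles; use assms one_notin_nonpos_Reals in auto)+
  have nz: "(of_real k)\<^sup>2 + a \<noteq> 0" if a: "a \<notin> \<real>\<^sub>\<le>\<^sub>0" for a :: complex and k :: real
  proof
    assume "(of_real k)\<^sup>2 + a = 0"
    then have "a = of_real (- (k\<^sup>2))"
      by (simp add: eq_neg_iff_add_eq_0 add.commute)
    then show False
      using a by (simp add: complex_nonpos_Reals_iff)
  qed
  have "(1 - a) * ?I a 1 k - (1 - b) * ?I b 1 k = (b - a) * ?I a b k" for k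
  proof -
    define u where "u = (complex_of_real k)\<^sup>2"
    have *: "u + a \<noteq> 0" "u + b \<noteq> 0" "u + 1 \<noteq> 0"
      unfolding u_def using assms nz one_notin_nonpos_Reals by auto
    have "(1 - a) * (1 / ((u + a) * (u + 1))) = 1 / (u + a) - 1 / (u + 1)"
      "(1 - b) * (1 / ((u + b) * (u + 1))) = 1 / (u + b) - 1 / (u + 1)"
      "(b - a) * (1 / ((u + a) * (u + b))) = 1 / (u + a) - 1 / (u + b)"
      using * by (simp_all add: divide_simps)
    then have "(1 - a) * (1 / ((u + a) * (u + 1))) - (1 - b) * (1 / ((u + b) * (u + 1))) = (b - a) * (1 / ((u + a) * (u + b)))"
      by simp
    then have "j k * ((1 - a) * (1 / ((u + a) * (u + 1))) - (1 - b) * (1 / ((u + b) * (u + 1)))) =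
        j k * ((b - a) * (1 / ((u + a) * (u + b))))"
      by simp
    then show ?thesis
      unfolding u_def by (simp add: right_diff_distrib mult_ac)
  qed
  then have "(\<integral>k. (1 - a) * ?I a 1 k - (1 - b) * ?I b 1 k \<partial>halfline) = (\<integral>k. (b - a) * ?I a b k \<partial>halfline)"
    by simp
  then have "(1 - a) * hankel_two_poles h a 1 - (1 - b) * hankel_two_poles h b 1 = (b - a) * hankel_two_poles h a b"
    unfolding hankel_two_poles_def
    using int unfolding j_def by (subst (asm) Bochner_Integration.integral_diff) (auto simp only: integral_mult_right_zero intro: integrable_mult_right)
  then show ?thesis
    using assms by (simp add: Bessel_K_0_slit_plane)
qed

lemma Bessel_K_0_cnj:
  assumes "h > 0" "a \<notin> \<real>\<^sub>\<le>\<^sub>0"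
  shows "Bessel_K 0 (of_real h * csqrt (cnj a)) = cnj (Bessel_K 0 (of_real h * csqrt a))"
proof -
  have "hankel_two_poles h (cnj a) 1 = cnj (hankel_two_poles h a 1)"
  proof -
    have eq: "of_real (k * Bessel_J 0 (k * h)) / (((of_real k)\<^sup>2 + cnj a) * ((of_real k)\<^sup>2 + 1)) =
        cnj (of_real (k * Bessel_J 0 (k * h)) / (((of_real k)\<^sup>2 + a) * ((of_real k)\<^sup>2 + 1)))" for k
      by simp
    show ?thesis
      unfolding hankel_two_poles_def eq by (rule Bochner_Integration.integral_cnj)
  qed
  moreover have "cnj a \<notin> \<real>\<^sub>\<le>\<^sub>0"
    using assms by (simp add: complex_nonpos_Reals_iff)
  ultimately show ?thesis
    using assms by (simp add: Bessel_K_0_slit_plane Bessel_K_0_real)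
qed

section \<open>The Spartan covariance function\<close>

text \<open>
  The constant is found from
  \<open>1 + \<eta> * x + x\<^sup>2 - c * (1 + x)\<^sup>2 = (1 - c) * (1 - x)\<^sup>2 + (2 + \<eta> - 4 * c) * x\<close> with \<open>x = k\<^sup>2\<close>.
\<close>

lemma spartan_denominator_ge:
  assumes "\<eta> > -2"
  obtains c :: real where "c > 0" "\<And>k. c * (1 + k\<^sup>2)\<^sup>2 \<le> 1 + \<eta> * k\<^sup>2 + k ^ 4"
proof
  define c where "c = min 1 ((2 + \<eta>) / 4)"
  show "c > 0" using assms by (simp add: c_def)
  fix k :: real
  have c: "c \<le> 1" "4 * c \<le> 2 + \<eta>"
    by (auto simp: c_def min_def)
  have "0 \<le> (1 - c) * (1 - k\<^sup>2)\<^sup>2 + (2 + \<eta> - 4 * c) * k\<^sup>2"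
    using c by (intro add_nonneg_nonneg mult_nonneg_nonneg) auto
  also have "\<dots> = 1 + \<eta> * k\<^sup>2 + k ^ 4 - c * (1 + k\<^sup>2)\<^sup>2"
    by (simp add: power2_eq_square power4_eq_xxxx algebra_simps)
  finally show "c * (1 + k\<^sup>2)\<^sup>2 \<le> 1 + \<eta> * k\<^sup>2 + k ^ 4"
    by simp
qed

lemma spartan_denominator_pos:
  fixes k :: real
  assumes "\<eta> > -2"
  shows "1 + \<eta> * k\<^sup>2 + k ^ 4 > 0"
proof -
  obtain c where c: "c > 0" "c * (1 + k\<^sup>2)\<^sup>2 \<le> 1 + \<eta> * k\<^sup>2 + k ^ 4"
    using spartan_denominator_ge[OF assms] by blast
  have "0 < c * (1 + k\<^sup>2)\<^sup>2"
    using c(1) by (intro mult_pos_pos zero_less_power add_pos_nonneg) auto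
  with c(2) show ?thesis by linarith
qed

text \<open>
  The dimensionless form of the covariance, with lag and wavenumber measured in units of \<open>\<xi>\<close>.
\<close>

definition spartan_integral :: "real \<Rightarrow> real \<Rightarrow> real" where
  "spartan_integral \<eta> h = (\<integral>k. k * Bessel_J 0 (k * h) / (1 + \<eta> * k\<^sup>2 + k ^ 4) \<partial>halfline)"

lemma spartan_integrand_majorant:
  assumes "\<eta> > -2"
  obtains c where "c > 0"
    "\<And>h k. h \<ge> 0 \<Longrightarrow> k > 0 \<Longrightarrow> norm (k * Bessel_J 0 (k * h) / (1 + \<eta> * k\<^sup>2 + k ^ 4)) \<le> 1 / c * (k / (1 + k\<^sup>2)\<^sup>2)"
proof -
  obtain c where c: "c > 0" "\<And>k. c * (1 + k\<^sup>2)\<^sup>2 \<le> 1 + \<eta> * k\<^sup>2 + k ^ 4"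
    using spartan_denominator_ge[OF assms] by blast
  show thesis
  proof (rule that[OF c(1)])
    fix h k :: real assume hk: "h \<ge> 0" "k > 0"
    have "c * (1 + k\<^sup>2)\<^sup>2 \<le> norm (1 + \<eta> * k\<^sup>2 + k ^ 4)"
      using c(2)[of k] by simp
    from norm_hankel_integrand_le[OF hk(2,1) c(1) this]
    show "norm (k * Bessel_J 0 (k * h) / (1 + \<eta> * k\<^sup>2 + k ^ 4)) \<le> 1 / c * (k / (1 + k\<^sup>2)\<^sup>2)"
      by (simp only: of_real_eq_id id_apply)
  qed
qed

lemma integrable_spartan_integrand:
  assumes "\<eta> > -2" "h \<ge> 0"
  shows "integrable halfline (\<lambda>k. k * Bessel_J 0 (k * h) / (1 + \<eta> * k\<^sup>2 + k ^ 4))"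
proof -
  obtain c where c: "c > 0" "\<And>k. c * (1 + k\<^sup>2)\<^sup>2 \<le> 1 + \<eta> * k\<^sup>2 + k ^ 4"
    using spartan_denominator_ge[OF assms(1)] by blast
  have bound: "c * (1 + k\<^sup>2)\<^sup>2 \<le> norm (1 + \<eta> * k\<^sup>2 + k ^ 4)" for k
    using c(2)[of k] by simp
  have "(\<lambda>k. 1 + \<eta> * k\<^sup>2 + k ^ 4) \<in> borel_measurable borel"
    by measurable
  from integrable_hankel_integrand[OF this assms(2) c(1) bound] show ?thesis
    by (simp only: of_real_eq_id id_apply)
qed

lemma ssrf_integrand_rescaled:
  assumes "\<eta> > -2" "\<xi> > 0" "r \<ge> 0"
  shows "set_integrable lborel {0..} (ssrf_integrand \<xi> \<eta> r)"
    and "(LBINT k:{0..}. ssrf_integrand \<xi> \<eta> r k) = spartan_integral \<eta> (r / \<xi>) / \<xi>\<^sup>2"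
proof -
  define g where "g = (\<lambda>k. k * Bessel_J 0 (k * (r / \<xi>)) / (1 + \<eta> * k\<^sup>2 + k ^ 4))"
  have eq: "ssrf_integrand \<xi> \<eta> r = (\<lambda>k. g (\<xi> * k) / \<xi>)"
    using assms by (auto simp: fun_eq_iff ssrf_integrand_def g_def mult.commute)
  have ind: "indicator {0..} k *\<^sub>R (g (\<xi> * k) / \<xi>) = indicator {0<..} k *\<^sub>R (g (\<xi> * k) / \<xi>)" for k
    by (cases "k = 0") (auto simp: g_def indicator_def)
  have g: "integrable halfline g" "integral\<^sup>L halfline g = spartan_integral \<eta> (r / \<xi>)"
    using integrable_spartan_integrand[of \<eta> "r / \<xi>"] assms by (simp_all add: g_def spartan_integral_def)
  have "integrable halfline (\<lambda>k. g (\<xi> * k) / \<xi>)"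
    using integral_halfline_scale(2)[OF assms(2), of g] g by (intro integrable_divide_zero) auto
  then show "set_integrable lborel {0..} (ssrf_integrand \<xi> \<eta> r)"
    unfolding set_integrable_def eq ind by (simp add: integrable_restrict_space)
  have "(LBINT k:{0..}. ssrf_integrand \<xi> \<eta> r k) = (\<integral>k. g (\<xi> * k) / \<xi> \<partial>halfline)"
    unfolding set_lebesgue_integral_def eq ind by (subst integral_restrict_space) auto
  also have "\<dots> = spartan_integral \<eta> (r / \<xi>) / \<xi>\<^sup>2"
    using integral_halfline_scale(1)[OF assms(2), of g] g assms(2)
    by (simp add: power2_eq_square field_simps)
  finally show "(LBINT k:{0..}. ssrf_integrand \<xi> \<eta> r k) = spartan_integral \<eta> (r / \<xi>) / \<xi>\<^sup>2" .
qed

lemma ssrf_cov_eq_spartan_integral: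
  assumes "\<eta> > -2" "\<xi> > 0"
  shows "ssrf_cov \<eta>0 \<xi> \<eta> r = \<eta>0 / (2 * pi) * spartan_integral \<eta> (norm r / \<xi>)"
  unfolding ssrf_cov_def using ssrf_integrand_rescaled(2)[OF assms, of "norm r"] assms by simp

text \<open>
  A square lies on the nonpositive real axis only if its root is purely imaginary.
\<close>

lemma ssrf_z_square_slit_plane:
  assumes "\<eta> > -2"
  shows "(ssrf_z_plus \<eta>)\<^sup>2 \<notin> \<real>\<^sub>\<le>\<^sub>0" "(ssrf_z_minus \<eta>)\<^sup>2 \<notin> \<real>\<^sub>\<le>\<^sub>0"
proof -
  have "z\<^sup>2 \<notin> \<real>\<^sub>\<le>\<^sub>0" if "0 < Re z" for z :: complex
  proof
    assume "z\<^sup>2 \<in> \<real>\<^sub>\<le>\<^sub>0"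
    then have "Im (z\<^sup>2) = 0" "Re (z\<^sup>2) \<le> 0"
      unfolding complex_nonpos_Reals_iff by auto
    then have "Im z = 0" "(Re z)\<^sup>2 \<le> (Im z)\<^sup>2"
      using that by (auto simp: Im_power2 Re_power2)
    then show False using that by simp
  qed
  then show "(ssrf_z_plus \<eta>)\<^sup>2 \<notin> \<real>\<^sub>\<le>\<^sub>0" "(ssrf_z_minus \<eta>)\<^sup>2 \<notin> \<real>\<^sub>\<le>\<^sub>0"
    using ssrf_z_Re_pos[OF assms] by blast+
qed

text \<open>
  The roots \<open>a\<close> and \<open>b\<close> have sum \<open>\<eta>\<close>, product \<open>1\<close> and difference \<open>b - a = ssrf_disc \<eta>\<close>.
\<close>

lemma spartan_integral_eq_Bessel_K:
  assumes "\<eta> > -2" "h > 0"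
  shows "ssrf_disc \<eta> * of_real (spartan_integral \<eta> h) =
    Bessel_K 0 (of_real h * ssrf_z_plus \<eta>) - Bessel_K 0 (of_real h * ssrf_z_minus \<eta>)"
proof -
  define a where "a = (ssrf_z_plus \<eta>)\<^sup>2"
  define b where "b = (ssrf_z_minus \<eta>)\<^sup>2"
  have slit: "a \<notin> \<real>\<^sub>\<le>\<^sub>0" "b \<notin> \<real>\<^sub>\<le>\<^sub>0"
    using ssrf_z_square_slit_plane[OF assms(1)] by (simp_all add: a_def b_def)
  have roots: "ssrf_z_plus \<eta> = csqrt a" "ssrf_z_minus \<eta> = csqrt b"
    unfolding a_def b_def ssrf_z_square by (simp_all add: ssrf_z_plus_def ssrf_z_minus_def)
  have disc: "(ssrf_disc \<eta>)\<^sup>2 = of_real \<eta> * of_real \<eta> - 4"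
    unfolding ssrf_disc_def power2_csqrt by (simp add: power2_eq_square)
  have ab: "b - a = ssrf_disc \<eta>" "a + b = of_real \<eta>"
    unfolding a_def b_def ssrf_z_square by (simp_all add: field_simps)
  have "a * b = ((of_real \<eta>) * (of_real \<eta>) - (ssrf_disc \<eta>)\<^sup>2) / 4"
    unfolding a_def b_def ssrf_z_square by (simp add: power2_eq_square field_simps)
  then have prod: "a * b = 1"
    unfolding disc by simp
  have "((of_real k)\<^sup>2 + a) * ((of_real k)\<^sup>2 + b) = of_real (1 + \<eta> * k\<^sup>2 + k ^ 4)" for k :: real
  proof -
    have "((of_real k)\<^sup>2 + a) * ((of_real k)\<^sup>2 + b) = a * b + (a + b) * (of_real k)\<^sup>2 + (of_real k) ^ 4"
      by (simp add: power2_eq_square power4_eq_xxxx algebra_simps)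
    then show ?thesis unfolding prod ab by simp
  qed
  then have "hankel_two_poles h a b = (\<integral>k. of_real (k * Bessel_J 0 (k * h) / (1 + \<eta> * k\<^sup>2 + k ^ 4)) \<partial>halfline)"
    unfolding hankel_two_poles_def by (simp only: of_real_divide)
  also have "\<dots> = of_real (spartan_integral \<eta> h)"
    unfolding spartan_integral_def by (rule integral_complex_of_real)
  finally have "hankel_two_poles h a b = of_real (spartan_integral \<eta> h)" .
  then show ?thesis
    using Bessel_K_0_diff[OF assms(2) slit] by (simp only: roots ab)
qed

lemma ssrf_cov_overdamped:
  assumes "\<eta> > 2" "\<xi> > 0" "r \<noteq> 0"
  shows "complex_of_real (ssrf_cov \<eta>0 \<xi> \<eta> r) =
    of_real \<eta>0 * (Bessel_K 0 (of_real (norm r / \<xi>) * ssrf_z_plus \<eta>)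
                   - Bessel_K 0 (of_real (norm r / \<xi>) * ssrf_z_minus \<eta>))
      / of_real (2 * pi * sqrt (\<eta>\<^sup>2 - 4))"
proof -
  define s where "s = sqrt (\<eta>\<^sup>2 - 4)"
  have "2\<^sup>2 < \<eta>\<^sup>2"
    using assms by (intro power_strict_mono) auto
  then have s: "s > 0" by (simp add: s_def)
  have h: "norm r / \<xi> > 0"
    using assms by simp
  have "ssrf_disc \<eta> = of_real s"
    using assms by (simp add: ssrf_disc_real s_def)
  with spartan_integral_eq_Bessel_K[of \<eta> "norm r / \<xi>"] h assms
  have K: "Bessel_K 0 (of_real (norm r / \<xi>) * ssrf_z_plus \<eta>) - Bessel_K 0 (of_real (norm r / \<xi>) * ssrf_z_minus \<eta>)
      = of_real (s * spartan_integral \<eta> (norm r / \<xi>))"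
    by simp
  have cov: "ssrf_cov \<eta>0 \<xi> \<eta> r = \<eta>0 / (2 * pi) * spartan_integral \<eta> (norm r / \<xi>)"
    using assms by (intro ssrf_cov_eq_spartan_integral) auto
  show ?thesis
    unfolding K cov s_def [symmetric] of_real_mult [symmetric] of_real_divide [symmetric] of_real_eq_iff
    using s by simp
qed

lemma ssrf_cov_critical:
  assumes "\<xi> > 0" "r \<noteq> 0"
  shows "complex_of_real (ssrf_cov \<eta>0 \<xi> 2 r) =
    of_real (\<eta>0 * (norm r / \<xi>) / (4 * pi)) * Bessel_K (-1) (of_real (norm r / \<xi>))"
proof -
  have "1 + 2 * k\<^sup>2 + k ^ 4 = (1 + k\<^sup>2)\<^sup>2" for k :: real
    by (simp add: power2_eq_square power4_eq_xxxx algebra_simps)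
  then have "spartan_integral 2 h = (\<integral>k. k * Bessel_J 0 (k * h) / (1 + k\<^sup>2)\<^sup>2 \<partial>halfline)" for h
    by (simp add: spartan_integral_def)
  moreover have h: "norm r / \<xi> > 0"
    using assms by simp
  ultimately have K: "complex_of_real (spartan_integral 2 (norm r / \<xi>)) =
      of_real (norm r / \<xi> / 2) * Bessel_K (-1) (of_real (norm r / \<xi>))"
    using hankel_transform_double_pole[OF h] by (simp only:)
  have cov: "ssrf_cov \<eta>0 \<xi> 2 r = \<eta>0 / (2 * pi) * spartan_integral 2 (norm r / \<xi>)"
    using assms by (intro ssrf_cov_eq_spartan_integral) auto
  show ?thesis
    unfolding cov of_real_mult K by (simp add: mult_ac)
qed

text \<open>
  Here \<open>z\<^sub>+\<close> and \<open>z\<^sub>-\<close> are complex conjugates, so the difference of the two Bessel functions is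
  \<open>2 * \<i>\<close> times an imaginary part, and \<open>\<i>\<close> cancels against the discriminant.
\<close>

lemma ssrf_cov_underdamped:
  assumes "\<bar>\<eta>\<bar> < 2" "\<xi> > 0" "r \<noteq> 0"
  shows "ssrf_cov \<eta>0 \<xi> \<eta> r =
    \<eta>0 * Im (Bessel_K 0 (of_real (norm r / \<xi>) * ssrf_z_plus \<eta>)) / (pi * sqrt (4 - \<eta>\<^sup>2))"
proof -
  define s where "s = sqrt (4 - \<eta>\<^sup>2)"
  define K where "K = Bessel_K 0 (of_real (norm r / \<xi>) * ssrf_z_plus \<eta>)"
  have "\<eta>\<^sup>2 < 2\<^sup>2"
    using assms by (metis abs_ge_zero power2_abs power_strict_mono zero_less_numeral)
  then have s: "s > 0" by (simp add: s_def)
  have h: "norm r / \<xi> > 0" and \<eta>: "\<eta> > -2"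
    using assms by auto
  have disc: "ssrf_disc \<eta> = \<i> * of_real s"
    using assms by (simp add: ssrf_disc_imaginary s_def)
  have conj: "(ssrf_z_minus \<eta>)\<^sup>2 = cnj ((ssrf_z_plus \<eta>)\<^sup>2)"
    unfolding ssrf_z_square disc by simp
  have roots: "ssrf_z_plus \<eta> = csqrt ((ssrf_z_plus \<eta>)\<^sup>2)" "ssrf_z_minus \<eta> = csqrt ((ssrf_z_minus \<eta>)\<^sup>2)"
    unfolding ssrf_z_square by (simp_all add: ssrf_z_plus_def ssrf_z_minus_def)
  have "Bessel_K 0 (of_real (norm r / \<xi>) * ssrf_z_minus \<eta>) = cnj K"
    using Bessel_K_0_cnj[OF h ssrf_z_square_slit_plane(1)[OF \<eta>]]
    unfolding conj [symmetric] roots [symmetric] K_def .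
  with spartan_integral_eq_Bessel_K[OF \<eta> h]
  have "\<i> * of_real s * of_real (spartan_integral \<eta> (norm r / \<xi>)) = K - cnj K"
    by (simp add: disc K_def)
  then have "Im (\<i> * of_real s * of_real (spartan_integral \<eta> (norm r / \<xi>))) = Im (K - cnj K)"
    by (rule arg_cong)
  then have "s * spartan_integral \<eta> (norm r / \<xi>) = 2 * Im K"
    by simp
  then have "spartan_integral \<eta> (norm r / \<xi>) = 2 * Im K / s"
    using s by (simp add: field_simps)
  then show ?thesis
    unfolding ssrf_cov_eq_spartan_integral[OF \<eta> assms(2)] K_def [symmetric] s_def [symmetric] by simp
qed

lemma spartan_integral_tendsto_0:
  assumes "\<eta> > -2"
  shows "(spartan_integral \<eta> \<longlongrightarrow> spartan_integral \<eta> 0) (at 0 within {0..})"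
proof -
  obtain c where c: "c > 0"
    "\<And>h k. h \<ge> 0 \<Longrightarrow> k > 0 \<Longrightarrow> norm (k * Bessel_J 0 (k * h) / (1 + \<eta> * k\<^sup>2 + k ^ 4)) \<le> 1 / c * (k / (1 + k\<^sup>2)\<^sup>2)"
    using spartan_integrand_majorant[OF assms] by blast
  show ?thesis
    unfolding spartan_integral_def
  proof (rule tendsto_integral_dominated)
    show "integrable halfline (\<lambda>k. 1 / c * (k / (1 + k\<^sup>2)\<^sup>2))"
      by (intro integrable_mult_right integrable_double_pole_majorant)
    show "\<forall>\<^sub>F h in at 0 within {0..}. \<forall>k\<in>space halfline.
        norm (k * Bessel_J 0 (k * h) / (1 + \<eta> * k\<^sup>2 + k ^ 4)) \<le> 1 / c * (k / (1 + k\<^sup>2)\<^sup>2)"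
      unfolding eventually_at_topological using c(2) by (intro exI[of _ UNIV]) auto
    show "((\<lambda>h. k * Bessel_J 0 (k * h) / (1 + \<eta> * k\<^sup>2 + k ^ 4)) \<longlongrightarrow> k * Bessel_J 0 (k * 0) / (1 + \<eta> * k\<^sup>2 + k ^ 4))
        (at 0 within {0..})" for k
    proof -
      have "isCont (Bessel_J 0) (k * 0)"
        using continuous_on_Bessel_J_0[of UNIV] continuous_on_eq_continuous_at[OF open_UNIV] by blast
      then have "((\<lambda>h. Bessel_J 0 (k * h)) \<longlongrightarrow> Bessel_J 0 (k * 0)) (at 0 within {0..})"
        by (rule isCont_tendsto_compose) (intro tendsto_intros)
      then show ?thesis
        using spartan_denominator_pos[OF assms, of k] by (intro tendsto_intros) auto
    qed
  qed (intro measurable_halflineI; measurable)+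
qed

lemma ssrf_cov_tendsto_0:
  assumes "\<eta> > -2" "\<xi> > 0"
  shows "(ssrf_cov \<eta>0 \<xi> \<eta> \<longlongrightarrow> ssrf_cov \<eta>0 \<xi> \<eta> 0) (at 0)"
proof -
  have "filterlim (\<lambda>r::real^2. norm r / \<xi>) (at 0 within {0..}) (at 0)"
    unfolding filterlim_at
  proof
    show "((\<lambda>r::real^2. norm r / \<xi>) \<longlongrightarrow> 0) (at 0)"
      by (rule tendsto_eq_intros refl | use assms in simp)+
    show "\<forall>\<^sub>F r::real^2 in at 0. norm r / \<xi> \<in> {0..} \<and> norm r / \<xi> \<noteq> 0"
      unfolding eventually_at_topological using assms by (intro exI[of _ UNIV]) auto
  qed
  from filterlim_compose[OF spartan_integral_tendsto_0[OF assms(1)] this]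
  have "((\<lambda>r::real^2. \<eta>0 / (2 * pi) * spartan_integral \<eta> (norm r / \<xi>)) \<longlongrightarrow> \<eta>0 / (2 * pi) * spartan_integral \<eta> 0) (at 0)"
    by (intro tendsto_intros)
  moreover have "ssrf_cov \<eta>0 \<xi> \<eta> = (\<lambda>r. \<eta>0 / (2 * pi) * spartan_integral \<eta> (norm r / \<xi>))"
    by (intro ext ssrf_cov_eq_spartan_integral assms)
  ultimately show ?thesis by simp
qed

text \<open>
  The loss \<open>I(0) - I(h)\<close> is the integral of the nonnegative function
  \<open>k * (1 - J\<^sub>0(k * h)) / (1 + \<eta> * k\<^sup>2 + k ^ 4)\<close>.  On \<open>1 \<le> k \<le> \<delta> / (2 * h)\<close> its integrand is at least
  \<open>h\<^sup>2 / (8 * C) * (1 / k)\<close>, which contributes a logarithm of \<open>1 / h\<close>.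
\<close>

lemma spartan_integral_variogram:
  assumes "\<eta> > -2"
  obtains d where "d > 0" "\<And>h. 0 < h \<Longrightarrow> h \<le> d \<Longrightarrow> B * h\<^sup>2 \<le> spartan_integral \<eta> 0 - spartan_integral \<eta> h"
proof -
  obtain \<delta> where \<delta>: "\<delta> > 0" "\<And>x. \<bar>x\<bar> < \<delta> \<Longrightarrow> x\<^sup>2 / 8 \<le> 1 - Bessel_J 0 x"
    using Bessel_J_0_quadratic_drop by blast
  define C where "C = 2 + \<bar>\<eta>\<bar>"
  have C: "C > 0" by (simp add: C_def)
  have lower: "h\<^sup>2 / (8 * C) * ln (\<delta> / 2 / h) \<le> spartan_integral \<eta> 0 - spartan_integral \<eta> h"
    if h: "0 < h" "h \<le> \<delta> / 2" for h
  proof -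
    define R where "R = \<delta> / 2 / h"
    have R: "R \<ge> 1"
      using h by (simp add: R_def)
    let ?D = "\<lambda>k. 1 + \<eta> * k\<^sup>2 + k ^ 4"
    have J0: "Bessel_J 0 0 = 1"
      by (simp add: Bessel_J_0_eq_bessel_series)
    have "has_bochner_integral lborel (\<lambda>k. indicator {1..R} k *\<^sub>R (1 / k)) (ln R - ln 1)"
    proof (rule has_bochner_integral_FTC_Icc[OF R])
      show "(ln has_vector_derivative 1 / k) (at k within {1..R})" if "1 \<le> k" for k
        using that by (auto intro!: derivative_eq_intros simp flip: has_real_derivative_iff_has_vector_derivative)
      show "continuous_on {1..R} (\<lambda>k. 1 / k)"
        by (intro continuous_intros) auto
    qed
    moreover have "(\<lambda>k. indicator {1..R} k *\<^sub>R (1 / k)) = (\<lambda>k. indicator {0<..} k *\<^sub>R (indicator {1..R} k * (1 / k)))"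
      by (auto simp: fun_eq_iff indicator_def)
    ultimately have log: "has_bochner_integral halfline (\<lambda>k. indicator {1..R} k * (1 / k)) (ln R)"
      by (subst has_bochner_integral_restrict_space) simp_all
    have "h\<^sup>2 / (8 * C) * ln R = (\<integral>k. h\<^sup>2 / (8 * C) * (indicator {1..R} k * (1 / k)) \<partial>halfline)"
      unfolding integral_mult_right_zero has_bochner_integral_integral_eq[OF log] ..
    also have "\<dots> \<le> (\<integral>k. k * Bessel_J 0 (k * 0) / ?D k - k * Bessel_J 0 (k * h) / ?D k \<partial>halfline)"
    proof (rule integral_mono)
      show "integrable halfline (\<lambda>k. h\<^sup>2 / (8 * C) * (indicator {1..R} k * (1 / k)))"
        by (intro integrable_mult_right integrable.intros[OF log])
      show "integrable halfline (\<lambda>k. k * Bessel_J 0 (k * 0) / ?D k - k * Bessel_J 0 (k * h) / ?D k)"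
        using assms h by (intro Bochner_Integration.integrable_diff integrable_spartan_integrand) auto
      fix k assume "k \<in> space halfline"
      then have k: "k > 0" by simp
      have D: "?D k > 0"
        using spartan_denominator_pos[OF assms] .
      have eq: "k * Bessel_J 0 (k * 0) / ?D k - k * Bessel_J 0 (k * h) / ?D k = k * (1 - Bessel_J 0 (k * h)) / ?D k"
        by (simp only: mult_zero_right J0) (simp add: diff_divide_distrib right_diff_distrib)
      show "h\<^sup>2 / (8 * C) * (indicator {1..R} k * (1 / k)) \<le> k * Bessel_J 0 (k * 0) / ?D k - k * Bessel_J 0 (k * h) / ?D k"
      proof (cases "k \<in> {1..R}")
        case True
        then have "k * h \<le> R * h"
          using h by (intro mult_right_mono) auto
        then have "\<bar>k * h\<bar> < \<delta>"
          using h k \<delta>(1) by (simp add: R_def abs_mult)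
        from \<delta>(2)[OF this] have drop: "(k * h)\<^sup>2 / 8 \<le> 1 - Bessel_J 0 (k * h)" .
        have "?D k \<le> C * k ^ 4"
        proof -
          have "1 \<le> k\<^sup>2" "1 \<le> k ^ 4"
            using True by auto
          have "k\<^sup>2 * 1 \<le> k\<^sup>2 * k\<^sup>2"
            using \<open>1 \<le> k\<^sup>2\<close> by (intro mult_left_mono) auto
          then have "k\<^sup>2 \<le> k ^ 4"
            by (simp add: power2_eq_square power4_eq_xxxx)
          then have "\<eta> * k\<^sup>2 \<le> \<bar>\<eta>\<bar> * k ^ 4"
            by (intro mult_mono) auto
          with \<open>1 \<le> k ^ 4\<close> show ?thesis
            by (simp add: C_def algebra_simps)
        qed
        have "h\<^sup>2 / (8 * C) * (1 / k) = k * ((k * h)\<^sup>2 / 8) / (C * k ^ 4)"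
          using k C by (simp add: power2_eq_square power4_eq_xxxx field_simps)
        also have "\<dots> \<le> k * ((k * h)\<^sup>2 / 8) / ?D k"
          using \<open>?D k \<le> C * k ^ 4\<close> D k C by (intro divide_left_mono mult_pos_pos) auto
        also have "\<dots> \<le> k * (1 - Bessel_J 0 (k * h)) / ?D k"
          using drop D k by (intro divide_right_mono mult_left_mono) auto
        finally show ?thesis
          unfolding eq using True by simp
      next
        case False
        have "Bessel_J 0 (k * h) \<le> 1"
          using abs_Bessel_J_0_le_1[of "k * h"] k h by (simp add: abs_le_iff)
        then show ?thesis
          unfolding eq using False D k by simp
      qed
    qed
    also have "\<dots> = spartan_integral \<eta> 0 - spartan_integral \<eta> h"
      unfolding spartan_integral_def using assms h
      by (intro Bochner_Integration.integral_diff integrable_spartan_integrand) auto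
    finally show ?thesis by (simp add: R_def)
  qed
  \<comment> \<open>Chosen so that \<open>ln (\<delta> / 2 / d) = 8 * C * \<bar>B\<bar>\<close>.\<close>
  define d where "d = \<delta> / 2 * exp (- (8 * C * \<bar>B\<bar>))"
  have "d > 0"
    using \<delta>(1) by (simp add: d_def)
  moreover have "B * h\<^sup>2 \<le> spartan_integral \<eta> 0 - spartan_integral \<eta> h" if h: "0 < h" "h \<le> d" for h
  proof -
    have "exp (- (8 * C * \<bar>B\<bar>)) \<le> 1"
      using C by simp
    then have "d \<le> \<delta> / 2"
      using \<delta>(1) mult_left_mono[of "exp (- (8 * C * \<bar>B\<bar>))" 1 "\<delta> / 2"] by (simp add: d_def)
    have "\<delta> / 2 / d = exp (8 * C * \<bar>B\<bar>)"
      using \<delta>(1) by (simp add: d_def exp_minus field_simps)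
    then have "8 * C * \<bar>B\<bar> = ln (\<delta> / 2 / d)"
      by simp
    also have "\<dots> \<le> ln (\<delta> / 2 / h)"
      using h \<delta>(1) \<open>d > 0\<close> by (intro ln_mono divide_left_mono) auto
    finally have "h\<^sup>2 / (8 * C) * (8 * C * \<bar>B\<bar>) \<le> h\<^sup>2 / (8 * C) * ln (\<delta> / 2 / h)"
      using C by (intro mult_left_mono) auto
    moreover have "B * h\<^sup>2 \<le> h\<^sup>2 / (8 * C) * (8 * C * \<bar>B\<bar>)"
      using C mult_right_mono[of B "\<bar>B\<bar>" "h\<^sup>2"] by (simp add: mult.commute)
    ultimately show ?thesis
      using lower[of h] h \<open>d \<le> \<delta> / 2\<close> by linarith
  qed
  ultimately show thesis by (rule that)
qed

section \<open>Mean square continuity and differentiability\<close>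

text \<open>
  The elementary inequality \<open>\<bar>y * z\<bar> \<le> y\<^sup>2 + z\<^sup>2\<close>.
\<close>

lemma integrable_mult_square_integrable:
  fixes Y Z :: "'w \<Rightarrow> real"
  assumes "finite_second_moment M Y" "finite_second_moment M Z"
  shows "integrable M (\<lambda>\<omega>. Y \<omega> * Z \<omega>)"
proof (rule Bochner_Integration.integrable_bound)
  have [measurable]: "Y \<in> borel_measurable M" "Z \<in> borel_measurable M"
    using assms by (auto simp: finite_second_moment_def)
  show "integrable M (\<lambda>\<omega>. (Y \<omega>)\<^sup>2 + (Z \<omega>)\<^sup>2)"
    using assms by (auto simp: finite_second_moment_def)
  show "AE \<omega> in M. norm (Y \<omega> * Z \<omega>) \<le> norm ((Y \<omega>)\<^sup>2 + (Z \<omega>)\<^sup>2)"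
  proof (rule AE_I2)
    fix \<omega>
    have "0 \<le> (\<bar>Y \<omega>\<bar> - \<bar>Z \<omega>\<bar>)\<^sup>2 + (Y \<omega>)\<^sup>2 + (Z \<omega>)\<^sup>2"
      by simp
    then have "2 * (\<bar>Y \<omega>\<bar> * \<bar>Z \<omega>\<bar>) \<le> 2 * ((Y \<omega>)\<^sup>2 + (Z \<omega>)\<^sup>2)"
      by (simp add: power2_diff)
    then show "norm (Y \<omega> * Z \<omega>) \<le> norm ((Y \<omega>)\<^sup>2 + (Z \<omega>)\<^sup>2)"
      by (simp add: abs_mult)
  qed
  show "(\<lambda>\<omega>. Y \<omega> * Z \<omega>) \<in> borel_measurable M"
    by measurable
qed

lemma finite_second_moment_diff:
  assumes "finite_second_moment M Y" "finite_second_moment M Z"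
  shows "finite_second_moment M (\<lambda>\<omega>. Y \<omega> - Z \<omega>)"
proof -
  have "integrable M (\<lambda>\<omega>. (Y \<omega>)\<^sup>2 - 2 * (Y \<omega> * Z \<omega>) + (Z \<omega>)\<^sup>2)"
    using assms integrable_mult_square_integrable[OF assms]
    by (intro Bochner_Integration.integrable_add Bochner_Integration.integrable_diff integrable_mult_right)
       (auto simp: finite_second_moment_def)
  then have "integrable M (\<lambda>\<omega>. (Y \<omega> - Z \<omega>)\<^sup>2)"
    by (simp add: power2_diff algebra_simps)
  then show ?thesis
    using assms by (auto simp: finite_second_moment_def)
qed

text \<open>
  The constant mean cancels from the increment, so the square expands into covariances.
\<close>

lemma second_order_stationary_variogram:
  assumes "second_order_stationary M X C"
  shows "(\<integral>\<omega>. (X (s + r) \<omega> - X s \<omega>)\<^sup>2 \<partial>M) = 2 * (C 0 - C r)"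
proof -
  interpret prob_space M
    using assms by (simp add: second_order_stationary_def)
  obtain m where m: "\<And>s. integral\<^sup>L M (X s) = m"
    using assms by (auto simp: second_order_stationary_def)
  have cov: "covariance M (X s) (X (s + r)) = C r" for s r
    using assms by (simp add: second_order_stationary_def)
  define Y where "Y = (\<lambda>s \<omega>. X s \<omega> - m)"
  have "finite_second_moment M (Y s)" for s
    unfolding Y_def using assms
    by (intro finite_second_moment_diff) (auto simp: second_order_stationary_def finite_second_moment_def)
  then have int: "integrable M (\<lambda>\<omega>. Y s \<omega> * Y t \<omega>)" for s t
    by (intro integrable_mult_square_integrable)
  have C: "(\<integral>\<omega>. Y s \<omega> * Y (s + r) \<omega> \<partial>M) = C r" for s r
    using cov[of s r] by (simp add: covariance_def Y_def m)
  have "(X (s + r) \<omega> - X s \<omega>)\<^sup>2 = Y (s + r) \<omega> * Y (s + r) \<omega> + Y s \<omega> * Y s \<omega> - 2 * (Y s \<omega> * Y (s + r) \<omega>)" for \<omega>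
    by (simp add: Y_def power2_eq_square algebra_simps)
  then have "(\<integral>\<omega>. (X (s + r) \<omega> - X s \<omega>)\<^sup>2 \<partial>M) =
      (\<integral>\<omega>. Y (s + r) \<omega> * Y (s + r) \<omega> \<partial>M) + (\<integral>\<omega>. Y s \<omega> * Y s \<omega> \<partial>M) - 2 * (\<integral>\<omega>. Y s \<omega> * Y (s + r) \<omega> \<partial>M)"
    using int by simp
  also have "\<dots> = 2 * (C 0 - C r)"
    using C[of "s + r" 0] C[of s 0] C[of s r] by simp
  finally show ?thesis .
qed

lemma ms_continuousI:
  assumes "second_order_stationary M X C" "(C \<longlongrightarrow> C 0) (at 0)"
  shows "ms_continuous M X"
  unfolding ms_continuous_def ms_tendsto_def
proof (intro allI conjI)
  fix s
  show "\<forall>\<^sub>F r in at 0. finite_second_moment M (X (s + r))" "finite_second_moment M (X s)"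
    using assms(1) by (auto simp: second_order_stationary_def)
  have "((\<lambda>r. 2 * (C 0 - C r)) \<longlongrightarrow> 2 * (C 0 - C 0)) (at 0)"
    by (intro tendsto_intros assms)
  then show "((\<lambda>r. \<integral>\<omega>. (X (s + r) \<omega> - X s \<omega>)\<^sup>2 \<partial>M) \<longlongrightarrow> 0) (at 0)"
    by (simp add: second_order_stationary_variogram[OF assms(1)])
qed

text \<open>
  Convergence in mean square of the difference quotients bounds their second moments, which are
  \<open>2 * (C 0 - C(t)) / t\<^sup>2\<close>.
\<close>

lemma not_ms_differentiableI:
  assumes stat: "second_order_stationary M X C"
    and unbounded: "\<And>B. \<forall>\<^sub>F t in at 0. B * t\<^sup>2 \<le> C 0 - C (t *\<^sub>R axis i 1)"
  shows "\<not> ms_differentiable M X"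
proof
  assume "ms_differentiable M X"
  then obtain D where D: "ms_tendsto M (\<lambda>t \<omega>. (X (0 + t *\<^sub>R axis i 1) \<omega> - X 0 \<omega>) / t) D (at 0)"
    unfolding ms_differentiable_def by blast
  define Q where "Q = (\<lambda>t \<omega>. (X (0 + t *\<^sub>R axis i 1) \<omega> - X 0 \<omega>) / t)"
  define B where "B = (\<integral>\<omega>. (D \<omega>)\<^sup>2 \<partial>M) + 1"
  have D2: "finite_second_moment M D"
    using D by (simp add: ms_tendsto_def)
  have Q: "\<forall>\<^sub>F t in at 0. finite_second_moment M (Q t)" "((\<lambda>t. \<integral>\<omega>. (Q t \<omega> - D \<omega>)\<^sup>2 \<partial>M) \<longlongrightarrow> 0) (at 0)"
    using D by (simp_all add: ms_tendsto_def Q_def)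
  from Q(2) have close: "\<forall>\<^sub>F t in at 0. (\<integral>\<omega>. (Q t \<omega> - D \<omega>)\<^sup>2 \<partial>M) < 1"
    by (rule order_tendstoD) simp
  have "\<forall>\<^sub>F t in at (0::real). t \<noteq> 0"
    by (simp add: eventually_at_filter)
  with Q(1) close unbounded[of B] have "\<forall>\<^sub>F t in at (0::real). False"
  proof eventually_elim
    case (elim t)
    have int: "integrable M (\<lambda>\<omega>. 2 * (Q t \<omega> - D \<omega>)\<^sup>2)" "integrable M (\<lambda>\<omega>. 2 * (D \<omega>)\<^sup>2)" "integrable M (\<lambda>\<omega>. (Q t \<omega>)\<^sup>2)"
      using finite_second_moment_diff[OF _ D2, of "Q t"] elim D2 by (auto simp: finite_second_moment_def)
    have "(\<integral>\<omega>. (Q t \<omega>)\<^sup>2 \<partial>M) \<le> (\<integral>\<omega>. 2 * (Q t \<omega> - D \<omega>)\<^sup>2 + 2 * (D \<omega>)\<^sup>2 \<partial>M)"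
    proof (rule integral_mono)
      fix \<omega>
      have "0 \<le> (Q t \<omega> - D \<omega> - D \<omega>)\<^sup>2"
        by simp
      then show "(Q t \<omega>)\<^sup>2 \<le> 2 * (Q t \<omega> - D \<omega>)\<^sup>2 + 2 * (D \<omega>)\<^sup>2"
        by (simp add: power2_eq_square algebra_simps)
    qed (use int in auto)
    also have "\<dots> = 2 * (\<integral>\<omega>. (Q t \<omega> - D \<omega>)\<^sup>2 \<partial>M) + 2 * (\<integral>\<omega>. (D \<omega>)\<^sup>2 \<partial>M)"
      using int by simp
    also have "\<dots> < 2 * B"
      using elim by (simp add: B_def)
    finally have upper: "(\<integral>\<omega>. (Q t \<omega>)\<^sup>2 \<partial>M) < 2 * B" .
    have "(\<integral>\<omega>. (Q t \<omega>)\<^sup>2 \<partial>M) = (\<integral>\<omega>. (X (0 + t *\<^sub>R axis i 1) \<omega> - X 0 \<omega>)\<^sup>2 \<partial>M) / t\<^sup>2"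
      by (simp add: Q_def power_divide)
    also have "\<dots> = 2 * (C 0 - C (t *\<^sub>R axis i 1)) / t\<^sup>2"
      unfolding second_order_stationary_variogram[OF stat] ..
    also have "\<dots> \<ge> 2 * B"
      using elim by (simp add: field_simps)
    finally show False using upper by simp
  qed
  then show False by simp
qed

theorem proposition1:
  fixes \<eta>0 \<xi> \<eta>1 :: real
  assumes "\<eta>0 > 0" and "\<xi> > 0" and "\<eta>1 > -2"
  shows
    "(\<forall>r :: real ^ 2. set_integrable lborel {0..} (ssrf_integrand \<xi> \<eta>1 (norm r))) \<and>
     (\<forall>(r :: real ^ 2) h. h = norm r / \<xi> \<and> h > 0 \<longrightarrow>
        (\<eta>1 > 2 \<longrightarrow>
           complex_of_real (ssrf_cov \<eta>0 \<xi> \<eta>1 r) =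
             of_real \<eta>0 * (Bessel_K 0 (of_real h * ssrf_z_plus \<eta>1)
                           - Bessel_K 0 (of_real h * ssrf_z_minus \<eta>1))
               / of_real (2 * pi * sqrt (\<eta>1\<^sup>2 - 4))) \<and>
        (\<eta>1 = 2 \<longrightarrow>
           complex_of_real (ssrf_cov \<eta>0 \<xi> \<eta>1 r) =
             of_real (\<eta>0 * h / (4 * pi)) * Bessel_K (-1) (of_real h)) \<and>
        (\<bar>\<eta>1\<bar> < 2 \<longrightarrow>
           ssrf_cov \<eta>0 \<xi> \<eta>1 r =
             \<eta>0 * Im (Bessel_K 0 (of_real h * ssrf_z_plus \<eta>1)) / (pi * sqrt (4 - \<eta>1\<^sup>2)))) \<and>
     (ssrf_cov \<eta>0 \<xi> \<eta>1 \<longlongrightarrow> ssrf_cov \<eta>0 \<xi> \<eta>1 0) (at 0) \<and>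
     (\<forall>(M :: 'w measure) X.
        second_order_stationary M X (ssrf_cov \<eta>0 \<xi> \<eta>1) \<longrightarrow>
          ms_continuous M X \<and> \<not> ms_differentiable M X)"
proof (intro conjI allI impI)
  show "set_integrable lborel {0..} (ssrf_integrand \<xi> \<eta>1 (norm r))" for r :: "real ^ 2"
    using assms by (intro ssrf_integrand_rescaled) auto
next
  fix r :: "real ^ 2" and h :: real
  assume h: "h = norm r / \<xi> \<and> h > 0"
  then have h_eq: "h = norm r / \<xi>" and "r \<noteq> 0"
    by auto
  show "complex_of_real (ssrf_cov \<eta>0 \<xi> \<eta>1 r) =
      of_real \<eta>0 * (Bessel_K 0 (of_real h * ssrf_z_plus \<eta>1) - Bessel_K 0 (of_real h * ssrf_z_minus \<eta>1))
        / of_real (2 * pi * sqrt (\<eta>1\<^sup>2 - 4))" if "\<eta>1 > 2"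
    unfolding h_eq using that assms(2) \<open>r \<noteq> 0\<close> by (rule ssrf_cov_overdamped)
  show "complex_of_real (ssrf_cov \<eta>0 \<xi> \<eta>1 r) = of_real (\<eta>0 * h / (4 * pi)) * Bessel_K (-1) (of_real h)" if "\<eta>1 = 2"
    unfolding h_eq that using assms(2) \<open>r \<noteq> 0\<close> by (rule ssrf_cov_critical)
  show "ssrf_cov \<eta>0 \<xi> \<eta>1 r = \<eta>0 * Im (Bessel_K 0 (of_real h * ssrf_z_plus \<eta>1)) / (pi * sqrt (4 - \<eta>1\<^sup>2))" if "\<bar>\<eta>1\<bar> < 2"
    unfolding h_eq using that assms(2) \<open>r \<noteq> 0\<close> by (rule ssrf_cov_underdamped)
next
  show "(ssrf_cov \<eta>0 \<xi> \<eta>1 \<longlongrightarrow> ssrf_cov \<eta>0 \<xi> \<eta>1 0) (at 0)"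
    using assms by (intro ssrf_cov_tendsto_0)
next
  fix M :: "'w measure" and X
  assume stat: "second_order_stationary M X (ssrf_cov \<eta>0 \<xi> \<eta>1)"
  show "ms_continuous M X"
    using stat ssrf_cov_tendsto_0[OF assms(3,2)] by (rule ms_continuousI)
  show "\<not> ms_differentiable M X"
    using stat
  proof (rule not_ms_differentiableI[where i = 1])
    fix B :: real
    define A where "A = B * \<xi>\<^sup>2 * (2 * pi / \<eta>0)"
    obtain d where d: "d > 0"
      "\<And>h. 0 < h \<Longrightarrow> h \<le> d \<Longrightarrow> A * h\<^sup>2 \<le> spartan_integral \<eta>1 0 - spartan_integral \<eta>1 h"
      using spartan_integral_variogram[OF assms(3), of A] by blast
    show "\<forall>\<^sub>F t in at 0. B * t\<^sup>2 \<le> ssrf_cov \<eta>0 \<xi> \<eta>1 0 - ssrf_cov \<eta>0 \<xi> \<eta>1 (t *\<^sub>R axis 1 1)"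
      unfolding eventually_at
    proof (intro exI[of _ "d * \<xi>"] conjI ballI impI)
      fix t :: real assume t: "t \<noteq> 0 \<and> dist t 0 < d * \<xi>"
      define h where "h = \<bar>t\<bar> / \<xi>"
      have h: "0 < h" "h \<le> d"
        using t assms(2) by (auto simp: h_def field_simps)
      have "norm (t *\<^sub>R axis 1 1 :: real ^ 2) = \<bar>t\<bar>"
        by simp
      then have "ssrf_cov \<eta>0 \<xi> \<eta>1 0 - ssrf_cov \<eta>0 \<xi> \<eta>1 (t *\<^sub>R axis 1 1) =
          \<eta>0 / (2 * pi) * (spartan_integral \<eta>1 0 - spartan_integral \<eta>1 h)"
        unfolding ssrf_cov_eq_spartan_integral[OF assms(3,2)] h_def by (simp add: right_diff_distrib)
      also have "\<dots> \<ge> \<eta>0 / (2 * pi) * (A * h\<^sup>2)"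
        using d(2)[OF h] assms(1) by (intro mult_left_mono) auto
      also have "\<eta>0 / (2 * pi) * (A * h\<^sup>2) = B * t\<^sup>2"
        using assms by (simp add: A_def h_def power_divide field_simps)
      finally show "B * t\<^sup>2 \<le> ssrf_cov \<eta>0 \<xi> \<eta>1 0 - ssrf_cov \<eta>0 \<xi> \<eta>1 (t *\<^sub>R axis 1 1)" .
    qed (use d assms in auto)
  qed
qed

end
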